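(* Let $n\ge 1$, let $\Omega_1,\dots,\Omega_n$ be Polish spaces, $\mathbf\Omega=\prod_{i=1}^n\Omega_i$, and $\mathbf c=(c_1,\dots,c_n)\in\mathbb R_+^n$. Let $G$ be a graph with vertex set $[n]$, let $\mathbf X=(X_1,\dots,X_n)$ be a $G$-dependent $\mathbf\Omega$-valued random vector, and let $f:\mathbf\Omega\to\mathbb R$ be (measurable and) forest-decomposable $\mathbf c$-Lipschitz with respect to $G$. Then for every $t>0$, $$\mathbb P\left(f(\mathbf X)-\mathbb E[f(\mathbf X)]\ge t\right)\le\exp\left(-\frac{2t^2}{D(G,\mathbf c)}\right),$$ where $$D(G,\mathbf c):=\min_{\{(F_k,w_k)\}_k\in\mathsf{FFC}(G)}\left(\sum_k w_k\sqrt{\sum_{\{i,j\}\in E(G[F_k])}(c_i+c_j)^2+\sum_{T\in\mathcal T(F_k)}c_{\min,k,T}^2}\right)^2$$ and $c_{\min,k,T}:=\min\{c_i:i\in T\}$ for all $T\in\mathcal T(F_k)$.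
   Context: $[n]=\{1,\dots,n\}$; $\mathbb R_+$ is the set of non-negative reals. Graphs are finite, undirected and simple; $V(G)$, $E(G)$ are the vertex and edge sets and $G[S]$ is the subgraph of $G$ induced by $S\subseteq V(G)$. A forest is a disjoint union of trees. For $V\subseteq[n]$, $\mathbf\Omega_V=\prod_{i\in V}\Omega_i$ and $\mathbf x_V=(x_i)_{i\in V}$. $X_i$ takes values in $\Omega_i$. $G$-dependence: $\mathbf X$ is $G$-dependent if for any disjoint $S,T\subset V(G)$ that are non-adjacent in $G$ (no edge of $G$ has one endpoint in $S$ and the other in $T$), the families $\{X_i\}_{i\in S}$ and $\{X_j\}_{j\in T}$ are independent. Lipschitz: for a set $V\subseteq[n]$, a function $g:\mathbf\Omega_V\to\mathbb R$ is $(c_i)_{i\in V}$-Lipschitz if $|g(\mathbf x)-g(\mathbf x')|\le\sum_{i\in V}c_i\mathbf 1_{\{x_i\neq x_i'\}}$ for all $\mathbf x,\mathbf x'\in\mathbf\Omega_V$. Fractional covers: a finite family $\{(S_k,w_k)\}_k$ with $S_k\subseteq V(G)$ and $w_k\in[0,1]$ is a fractional vertex cover of $G$ if $\sum_{k:v\in S_k}w_k=1$ for every $v\in V(G)$. A fractional forest vertex cover $\{(F_k,w_k)\}_k$ is a fractional vertex cover such that each $G[F_k]$ is a forest. $\mathsf{FFC}(G)$ is the set of all fractional forest vertex covers of $G$. $\mathcal T(F_k)$ is the set of vertex sets of the disjoint trees (connected components) of the forest $G[F_k]$. Forest-decomposable: $f:\mathbf\Omega\to\mathbb R$ is forest-decomposable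 $\mathbf c$-Lipschitz with respect to $G$ if for every $\{(F_k,w_k)\}_k\in\mathsf{FFC}(G)$ there exist (measurable) $(c_i)_{i\in F_k}$-Lipschitz functions $f_k:\mathbf\Omega_{F_k}\to\mathbb R$ such that $f(\mathbf x)=\sum_k w_kf_k(\mathbf x_{F_k})$ for all $\mathbf x\in\mathbf\Omega$. *)

theory Defs
  imports "HOL-Probability.Probability"
begin

section \<open>Simple graphs\<close>

text \<open>
  Graphs are pairs of a vertex set and a set of two-element edges.  The notions of forest and tree in
  \<^verbatim>\<open>Graph_Theory\<close> are for digraphs: there an undirected edge, seen as two opposite
  arcs, is already a cycle.
\<close>

type_synonym 'v sgraph = "'v set \<times> 'v set set"

abbreviation verts :: "'v sgraph \<Rightarrow> 'v set" where
  "verts G \<equiv> fst G"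

abbreviation edges :: "'v sgraph \<Rightarrow> 'v set set" where
  "edges G \<equiv> snd G"

definition simple_graph :: "'v sgraph \<Rightarrow> bool" where
  "simple_graph G \<longleftrightarrow> finite (verts G) \<and>
     (\<forall>e\<in>edges G. \<exists>u\<in>verts G. \<exists>v\<in>verts G. u \<noteq> v \<and> e = {u, v})"

definition adjacent :: "'v sgraph \<Rightarrow> 'v \<Rightarrow> 'v \<Rightarrow> bool" where
  "adjacent G u v \<longleftrightarrow> {u, v} \<in> edges G"

definition induced :: "'v sgraph \<Rightarrow> 'v set \<Rightarrow> 'v sgraph" where
  "induced G S = (S, {e \<in> edges G. e \<subseteq> S})"

definition component_of :: "'v sgraph \<Rightarrow> 'v \<Rightarrow> 'v set" where
  "component_of G u = {v \<in> verts G. (adjacent G)\<^sup>*\<^sup>* u v}"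

definition component_sets :: "'v sgraph \<Rightarrow> 'v set set" where
  "component_sets G = component_of G ` verts G"

definition is_cycle :: "'v sgraph \<Rightarrow> 'v list \<Rightarrow> bool" where
  "is_cycle G p \<longleftrightarrow> 3 \<le> length p \<and> distinct p \<and>
     (\<forall>i<length p. adjacent G (p ! i) (p ! (Suc i mod length p)))"

definition is_tree :: "'v sgraph \<Rightarrow> bool" where
  "is_tree G \<longleftrightarrow> verts G \<noteq> {} \<and> (\<forall>u\<in>verts G. \<forall>v\<in>verts G. (adjacent G)\<^sup>*\<^sup>* u v) \<and>
     \<not> (\<exists>p. is_cycle G p)"

text \<open>The graph without vertices is a forest (the union of no trees), but not a tree.\<close>

definition is_forest :: "'v sgraph \<Rightarrow> bool" where
  "is_forest G \<longleftrightarrow> (\<forall>T\<in>component_sets G. is_tree (induced G T))"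


section \<open>Fractional forest vertex covers\<close>

text \<open>
  A finite family \<open>{(S_k, w_k)}_k\<close> is a list of pairs, so that members may be repeated.
\<close>

definition fractional_cover :: "'v sgraph \<Rightarrow> ('v set \<times> real) list \<Rightarrow> bool" where
  "fractional_cover G C \<longleftrightarrow>
     (\<forall>(S, w)\<in>set C. S \<subseteq> verts G \<and> 0 \<le> w \<and> w \<le> 1) \<and>
     (\<forall>v\<in>verts G. (\<Sum>k | k < length C \<and> v \<in> fst (C ! k). snd (C ! k)) = 1)"

definition FFC :: "'v sgraph \<Rightarrow> ('v set \<times> real) list set" where
  "FFC G = {C. fractional_cover G C \<and> (\<forall>(F, w)\<in>set C. is_forest (induced G F))}"

text \<open>For an edge \<open>e = {i, j}\<close> the inner sum \<open>\<Sum>i\<in>e. c i\<close> is \<open>c i + c j\<close>.\<close>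

definition cover_cost :: "'v sgraph \<Rightarrow> ('v \<Rightarrow> real) \<Rightarrow> ('v set \<times> real) list \<Rightarrow> real" where
  "cover_cost G c C =
     (\<Sum>k<length C. snd (C ! k) *
        sqrt ((\<Sum>e\<in>edges (induced G (fst (C ! k))). (\<Sum>i\<in>e. c i)\<^sup>2) +
              (\<Sum>T\<in>component_sets (induced G (fst (C ! k))). (Min (c ` T))\<^sup>2)))\<^sup>2"

text \<open>
  The minimum over the infinite set \<open>FFC G\<close> exists: the square root of the cost depends on the cover
  only through the total weight given to each of the finitely many vertex sets inducing a forest,
  and it is linear in these weights, which range over a nonempty compact polytope.
\<close>

definition D_cost :: "'v sgraph \<Rightarrow> ('v \<Rightarrow> real) \<Rightarrow> real" where
  "D_cost G c = (LEAST d. \<exists>C\<in>FFC G. d = cover_cost G c C)"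


section \<open>Products of Polish spaces and dependence\<close>

text \<open>
  The spaces \<open>\<Omega> i\<close> are topologies with arbitrary carriers \<open>topspace (\<Omega> i)\<close> in one type, which can be
  any type (for instance one containing the disjoint union of the given spaces).  Points of the product over
  \<open>V\<close> are functions in \<open>PiE V\<close>, and the subfamily of \<open>x\<close> indexed by \<open>S\<close> is \<open>restrict x S\<close>.
\<close>

definition polish_top :: "'a topology \<Rightarrow> bool" where
  "polish_top X \<longleftrightarrow> separable_space X \<and> completely_metrizable_space X"

definition borel_top :: "'a topology \<Rightarrow> 'a measure" where
  "borel_top X = sigma (topspace X) {U. openin X U}"

text \<open>
  For countable \<open>V\<close> and Polish \<open>\<Omega> i\<close> the product sigma-algebra is the Borel sigma-algebra of the product
  topology.
\<close>

definition prod_space :: "('i \<Rightarrow> 'a topology) \<Rightarrow> 'i set \<Rightarrow> ('i \<Rightarrow> 'a) measure" where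
  "prod_space \<Omega> V = PiM V (\<lambda>i. borel_top (\<Omega> i))"

definition graph_dependent ::
  "'w measure \<Rightarrow> ('i \<Rightarrow> 'a topology) \<Rightarrow> 'i sgraph \<Rightarrow> ('w \<Rightarrow> 'i \<Rightarrow> 'a) \<Rightarrow> bool" where
  "graph_dependent M \<Omega> G X \<longleftrightarrow>
     (\<forall>S T. S \<subseteq> verts G \<and> T \<subseteq> verts G \<and> S \<inter> T = {} \<and> (\<forall>u\<in>S. \<forall>v\<in>T. \<not> adjacent G u v) \<longrightarrow>
        prob_space.indep_var M (prod_space \<Omega> S) (\<lambda>\<omega>. restrict (X \<omega>) S)
                               (prod_space \<Omega> T) (\<lambda>\<omega>. restrict (X \<omega>) T))"

definition lipschitz_coord ::
  "('i \<Rightarrow> 'a topology) \<Rightarrow> ('i \<Rightarrow> real) \<Rightarrow> 'i set \<Rightarrow> (('i \<Rightarrow> 'a) \<Rightarrow> real) \<Rightarrow> bool" where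
  "lipschitz_coord \<Omega> c V g \<longleftrightarrow>
     (\<forall>x\<in>PiE V (\<lambda>i. topspace (\<Omega> i)). \<forall>x'\<in>PiE V (\<lambda>i. topspace (\<Omega> i)).
        \<bar>g x - g x'\<bar> \<le> (\<Sum>i\<in>V. c i * of_bool (x i \<noteq> x' i)))"

definition forest_decomposable ::
  "('i \<Rightarrow> 'a topology) \<Rightarrow> ('i \<Rightarrow> real) \<Rightarrow> 'i sgraph \<Rightarrow> (('i \<Rightarrow> 'a) \<Rightarrow> real) \<Rightarrow> bool" where
  "forest_decomposable \<Omega> c G f \<longleftrightarrow>
     (\<forall>C\<in>FFC G. \<exists>g :: nat \<Rightarrow> ('i \<Rightarrow> 'a) \<Rightarrow> real.
        (\<forall>k<length C. g k \<in> borel_measurable (prod_space \<Omega> (fst (C ! k))) \<and>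
                      lipschitz_coord \<Omega> c (fst (C ! k)) (g k)) \<and>
        (\<forall>x\<in>PiE (verts G) (\<lambda>i. topspace (\<Omega> i)).
           f x = (\<Sum>k<length C. snd (C ! k) * g k (restrict x (fst (C ! k))))))"

end

theory Submission
  imports Defs
begin

text \<open>
  For a forest, reveal the coordinates leaves first, ending each component at a vertex of minimal \<open>c\<close>.
  Given the coordinates already revealed, a leaf \<open>i\<close> with neighbour \<open>p\<close> is independent of everything but
  \<open>p\<close>, so revealing it moves the conditional expectation of a Lipschitz function within an interval of
  length \<open>c i + c p\<close> (of length \<open>c i\<close> when \<open>i\<close> is the last vertex of its component).  Hoeffding's lemma at each step
  bounds the moment generating function by the sum of the squared lengths.  To avoid regular
  conditional distributions this is carried out for vectors with finitely many values.  The general case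
  is reduced to these: Polish spaces embed as Borel sets into a product of real lines, Lusin's theorem gives a compact
  set on which the function is continuous, and a McShane extension from that set yields a Lipschitz
  function of finitely many cells.  The members of a cover are combined by convexity of \<open>exp\<close>.
\<close>

section \<open>Leaves of forests\<close>

text \<open>Graph dependence is not stable under conditioning: fixing one coordinate may couple its
  neighbours. A vertex with at most one remaining neighbour has no pair to couple, which is why
  forests are needed and why leaves come first. In such an order every edge is charged once,
  together with its leaf, and every component once more for its last vertex.

  The reduction to finitely many values cannot rely on fine cells alone, because a function that is
  Lipschitz for the Hamming distance need not be continuous in any coordinate; an exceptional set of
  small probability has to be allowed. The cells are taken coordinate by coordinate, so that they
  inherit the dependence structure.

  In the convex combination for a cover, a member gets weight proportional to \<open>w k\<close>
  times the root of its cost, the choice for which all members yield the same exponential bound. As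
  a cost may vanish, each root is first increased by \<epsilon>, which tends to 0 at the
  end.\<close>

definition forest_cost :: "'v sgraph \<Rightarrow> ('v \<Rightarrow> real) \<Rightarrow> 'v set \<Rightarrow> real" where
  "forest_cost G c R = (\<Sum>e\<in>edges (induced G R). (\<Sum>i\<in>e. c i)\<^sup>2) +
     (\<Sum>T\<in>component_sets (induced G R). (Min (c ` T))\<^sup>2)"

lemma adjacent_induced [simp]:
  "adjacent (induced G R) u v \<longleftrightarrow> adjacent G u v \<and> u \<in> R \<and> v \<in> R"
  by (auto simp: adjacent_def induced_def)

lemma verts_induced [simp]: "verts (induced G R) = R"
  by (simp add: induced_def)

lemma adjacent_sym: "adjacent G u v \<Longrightarrow> adjacent G v u"
  by (simp add: adjacent_def insert_commute)

lemma adjacent_irrefl: "simple_graph G \<Longrightarrow> \<not> adjacent G u u"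
  unfolding simple_graph_def adjacent_def by (auto simp: doubleton_eq_iff)

text \<open>A cycle is connected and hence lies in the component of its first vertex, which is a
  tree. The inductions use acyclicity in this form because it passes directly to subsets of the
  vertices.\<close>

lemma forest_no_cycle:
  assumes "is_forest (induced G F)"
  shows "\<not> is_cycle (induced G F) p"
proof
  assume cyc: "is_cycle (induced G F) p"
  hence len: "3 \<le> length p" and dist: "distinct p"
    and adj: "\<And>i. i < length p \<Longrightarrow> adjacent (induced G F) (p ! i) (p ! (Suc i mod length p))"
    by (auto simp: is_cycle_def)
  let ?T = "component_of (induced G F) (p ! 0)"
  have inF: "p ! i \<in> F" if "i < length p" for i
    using adj[OF that] by simp
  have reach: "(adjacent (induced G F))\<^sup>*\<^sup>* (p ! 0) (p ! i)" if "i < length p" for i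
    using that
  proof (induction i)
    case (Suc i)
    then have "adjacent (induced G F) (p ! i) (p ! Suc i)"
      using adj[of i] by simp
    with Suc show ?case by (meson Suc_lessD rtranclp.rtrancl_into_rtrancl)
  qed auto
  have inT: "p ! i \<in> ?T" if "i < length p" for i
    using reach[OF that] inF[OF that] by (simp add: component_of_def)
  have "0 < length p" using len by linarith
  hence "p ! 0 \<in> F" by (rule inF)
  hence "?T \<in> component_sets (induced G F)"
    by (simp add: component_sets_def)
  hence "is_tree (induced (induced G F) ?T)"
    using assms by (auto simp: is_forest_def)
  moreover have "is_cycle (induced (induced G F) ?T) p"
    unfolding is_cycle_def
  proof (intro conjI allI impI)
    fix i assume i: "i < length p"
    have "Suc i mod length p < length p" using len by (intro mod_less_divisor) linarith
    with adj[OF i] inT[OF i] inT[of "Suc i mod length p"]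
    show "adjacent (induced (induced G F) ?T) (p ! i) (p ! (Suc i mod length p))"
      by (simp)
  qed (use len dist in auto)
  ultimately show False by (auto simp: is_tree_def)
qed

lemma no_cycle_mono:
  assumes "\<not> is_cycle (induced G F) p" "R \<subseteq> F"
  shows "\<not> is_cycle (induced G R) p"
  using assms unfolding is_cycle_def adjacent_induced by blast

section \<open>Longest paths in acyclic graphs\<close>

definition is_path :: "'v sgraph \<Rightarrow> 'v set \<Rightarrow> 'v list \<Rightarrow> bool" where
  "is_path G R p \<longleftrightarrow> p \<noteq> [] \<and> distinct p \<and> set p \<subseteq> R \<and>
     (\<forall>i. Suc i < length p \<longrightarrow> adjacent G (p ! i) (p ! Suc i))"

lemma is_path_rev: "is_path G R p \<Longrightarrow> is_path G R (rev p)"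
  unfolding is_path_def
proof (elim conjE, intro conjI allI impI)
  fix i
  assume adj: "\<forall>i. Suc i < length p \<longrightarrow> adjacent G (p ! i) (p ! Suc i)"
    and i: "Suc i < length (rev p)"
  define j where "j = length p - Suc (Suc i)"
  have j: "Suc j < length p" "rev p ! i = p ! Suc j" "rev p ! Suc i = p ! j"
    using i by (auto simp: rev_nth j_def Suc_diff_Suc)
  show "adjacent G (rev p ! i) (rev p ! Suc i)"
    using adj j adjacent_sym by metis
qed auto

lemma ex_longest_path:
  assumes "finite R" "R \<noteq> {}"
  obtains p where "is_path G R p" "\<And>q. is_path G R q \<Longrightarrow> length q \<le> length p"
proof -
  have fin: "finite {p. is_path G R p}"
    by (rule finite_subset[OF _ finite_subset_distinct[OF assms(1)]]) (auto simp: is_path_def)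
  obtain v where "v \<in> R" using assms by blast
  hence "is_path G R [v]" by (auto simp: is_path_def)
  hence "{p. is_path G R p} \<noteq> {}" by blast
  hence "Max (length ` {p. is_path G R p}) \<in> length ` {p. is_path G R p}"
    using fin by (intro Max_in) auto
  then obtain p where p: "is_path G R p" "length p = Max (length ` {p. is_path G R p})"
    by auto
  have "length q \<le> length p" if "is_path G R q" for q
    unfolding p(2) using fin that by (intro Max_ge) auto
  with p(1) that show thesis by blast
qed

text \<open>A neighbour outside the path would extend it. A neighbour at position j closes the
  segment from j to the end into a cycle, which has at least three vertices unless j is the last
  position but one.\<close>

lemma longest_path_last:
  assumes sg: "simple_graph G" and p: "is_path G R p"
    and max: "\<And>q. is_path G R q \<Longrightarrow> length q \<le> length p"
    and ac: "\<And>q. \<not> is_cycle (induced G R) q"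
    and v: "adjacent G (last p) v" "v \<in> R"
  shows "2 \<le> length p \<and> v = p ! (length p - 2)"
proof -
  have p': "p \<noteq> []" "distinct p" "set p \<subseteq> R"
    "\<And>i. Suc i < length p \<Longrightarrow> adjacent G (p ! i) (p ! Suc i)"
    using p by (auto simp: is_path_def)
  have last: "last p = p ! (length p - 1)" using p' by (simp add: last_conv_nth)
  have "v \<in> set p"
  proof (rule ccontr)
    assume nv: "v \<notin> set p"
    have "is_path G R (p @ [v])"
      unfolding is_path_def
    proof (intro conjI allI impI)
      fix i assume i: "Suc i < length (p @ [v])"
      show "adjacent G ((p @ [v]) ! i) ((p @ [v]) ! Suc i)"
      proof (cases "Suc i = length p")
        case True
        hence "i = length p - 1" by simp
        thus ?thesis using v last p' True by (simp add: nth_append)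
      next
        case False
        thus ?thesis using i p' by (simp add: nth_append)
      qed
    qed (use p' v nv in auto)
    from max[OF this] show False by simp
  qed
  then obtain j where j: "j < length p" "v = p ! j" by (auto simp: in_set_conv_nth)
  have j1: "j \<noteq> length p - 1" using adjacent_irrefl[OF sg] v j last by metis
  show ?thesis
  proof (cases "j = length p - 2")
    case True thus ?thesis using j j1 by simp
  next
    case False
    let ?q = "drop j p"
    have len: "3 \<le> length ?q" using False j j1 by simp
    have "is_cycle (induced G R) ?q"
      unfolding is_cycle_def
    proof (intro conjI allI impI)
      fix i assume i: "i < length ?q"
      show "adjacent (induced G R) (?q ! i) (?q ! (Suc i mod length ?q))"
      proof (cases "Suc i = length ?q")
        case True
        hence "j + i = length p - 1" using j by simp
        hence "?q ! i = last p" "?q ! (Suc i mod length ?q) = v"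
          using j last True by auto
        thus ?thesis using v p' by (auto simp: last_in_set subsetD)
      next
        case False
        hence "Suc (j + i) < length p" using i by simp
        from p'(4)[OF this] this False i show ?thesis
          using p'(3) by (auto simp: subsetD)
      qed
    qed (use len p' in auto)
    thus ?thesis using ac by blast
  qed
qed

lemma is_path_reach:
  assumes "is_path G R p" "i < length p"
  shows "(adjacent (induced G R))\<^sup>*\<^sup>* (p ! 0) (p ! i)"
  using assms(2)
proof (induction i)
  case (Suc i)
  hence "adjacent (induced G R) (p ! i) (p ! Suc i)"
    using assms(1) by (auto simp: is_path_def subset_iff)
  with Suc show ?case by (meson Suc_lessD rtranclp.rtrancl_into_rtrancl)
qed auto

text \<open>
  The two ends of a longest path are leaves of the same component; removing the one with the larger
  \<open>c\<close> keeps the minimum of \<open>c\<close> over the component.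
\<close>

lemma ex_removable_vertex:
  fixes c :: "'v \<Rightarrow> real"
  assumes sg: "simple_graph G" and fin: "finite R" "R \<noteq> {}"
    and ac: "\<And>q. \<not> is_cycle (induced G R) q"
  shows "\<exists>i\<in>R. (\<forall>v\<in>R. \<not> adjacent G i v) \<or>
     (\<exists>p\<in>R. \<exists>j\<in>R. adjacent G i p \<and> (\<forall>v\<in>R. adjacent G i v \<longrightarrow> v = p) \<and> j \<noteq> i \<and> c j \<le> c i \<and>
        (adjacent (induced G R))\<^sup>*\<^sup>* i j)"
proof -
  obtain p where p: "is_path G R p" and max: "\<And>q. is_path G R q \<Longrightarrow> length q \<le> length p"
    using ex_longest_path[OF fin, of G] by blast
  have pr: "p \<noteq> []" "distinct p" "set p \<subseteq> R" using p by (auto simp: is_path_def)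
  note L = longest_path_last[OF sg p max ac]
  \<comment> \<open>The reversed path is a longest one as well, so the same lemma describes the
    neighbours of the first vertex.\<close>
  note H = longest_path_last[OF sg is_path_rev[OF p] _ ac, simplified, OF max]
  show ?thesis
  proof (cases "length p \<ge> 2")
    \<comment> \<open>On a one-vertex path \<open>L\<close> leaves no room for a neighbour, so the
      vertex is isolated in \<open>R\<close>.\<close>
    case False
    have "last p \<in> R" using pr by auto
    thus ?thesis using L False by blast
  next
    case True
    let ?a = "hd p" and ?b = "last p"
    have ab: "?a \<in> R" "?b \<in> R" using pr by (auto simp: subset_iff)
    have a0: "?a = p ! 0" "?b = p ! (length p - 1)" using pr by (auto simp: hd_conv_nth last_conv_nth)
    have ne: "?a \<noteq> ?b" using a0 True pr by (simp add: nth_eq_iff_index_eq)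
    have r: "(adjacent (induced G R))\<^sup>*\<^sup>* ?a ?b" using is_path_reach[OF p] a0 pr by simp
    have "symp (adjacent (induced G R))" by (auto simp: symp_def intro: adjacent_sym)
    hence r': "(adjacent (induced G R))\<^sup>*\<^sup>* ?b ?a" using r
      by (meson symp_rtranclp sympD)
    have adj: "Suc i < length p \<Longrightarrow> adjacent G (p ! i) (p ! Suc i)" for i
      using p by (auto simp: is_path_def)
    have A: "adjacent G ?a (p ! 1)" using adj[of 0] True a0 by simp
    have "Suc (length p - 2) = length p - 1" using True by simp
    hence B: "adjacent G (p ! (length p - 2)) ?b" using adj[of "length p - 2"] True a0 by simp
    hence B': "adjacent G ?b (p ! (length p - 2))" by (rule adjacent_sym)
    have in1: "p ! 1 \<in> R" "p ! (length p - 2) \<in> R" using pr True by (auto intro!: subsetD[OF pr(3)])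
    have revp: "rev p ! (length p - 2) = p ! 1"
      using True by (subst rev_nth) (auto simp: Suc_diff_Suc numeral_2_eq_2)
    have Lb: "\<forall>v\<in>R. adjacent G ?b v \<longrightarrow> v = p ! (length p - 2)" using L by blast
    have La: "\<forall>v\<in>R. adjacent G ?a v \<longrightarrow> v = p ! 1"
      using H pr revp by (auto simp: last_rev)
    show ?thesis
    proof (cases "c ?a \<le> c ?b")
      case True
      show ?thesis
        by (rule bexI[of _ ?b], rule disjI2, rule bexI[of _ "p ! (length p - 2)"],
            rule bexI[of _ ?a], intro conjI)
          (fact ab B' in1 Lb ne True r')+
    next
      case False
      hence le: "c ?b \<le> c ?a" by simp
      show ?thesis
        by (rule bexI[of _ ?a], rule disjI2, rule bexI[of _ "p ! 1"],
            rule bexI[of _ ?b], intro conjI)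
          (fact ab A in1 La ne[symmetric] le r)+
    qed
  qed
qed

section \<open>Components and cost after the deletion of a vertex\<close>

lemma component_of_induced:
  "component_of (induced G R) u = {v \<in> R. (adjacent (induced G R))\<^sup>*\<^sup>* u v}"
  by (simp add: component_of_def)

lemma component_of_refl: "u \<in> R \<Longrightarrow> u \<in> component_of (induced G R) u"
  by (simp add: component_of_induced)

lemma component_of_eq:
  assumes "v \<in> component_of (induced G R) u"
  shows "component_of (induced G R) v = component_of (induced G R) u"
proof -
  have "symp (adjacent (induced G R))" by (auto simp: symp_def intro: adjacent_sym)
  hence "(adjacent (induced G R))\<^sup>*\<^sup>* v u" "(adjacent (induced G R))\<^sup>*\<^sup>* u v"
    using assms by (auto simp: component_of_induced dest: sympD[OF symp_rtranclp])
  thus ?thesis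
    by (auto simp: component_of_induced intro: rtranclp_trans)
qed

text \<open>A walk that starts elsewhere can visit i only as a detour from p back to p, which is cut
  out. The clause for \<open>v = i\<close> carries the induction through the middle of a detour,
  where the shortened walk is still waiting at p.\<close>

lemma reach_remove_leaf:
  assumes leaf: "\<And>v. v \<in> R \<Longrightarrow> adjacent G i v \<Longrightarrow> v = p"
    and "(adjacent (induced G R))\<^sup>*\<^sup>* u v" "u \<noteq> i"
  shows "if v = i then (adjacent (induced G (R - {i})))\<^sup>*\<^sup>* u p
         else (adjacent (induced G (R - {i})))\<^sup>*\<^sup>* u v"
  using assms(2)
proof (induction rule: rtranclp_induct)
  case base
  thus ?case using assms(3) by simp
next
  case (step y z)
  show ?case
  proof (cases "y = i \<or> z = i")
    case True
    have s: "adjacent G y z" "adjacent G z y" "y \<in> R" "z \<in> R"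
      using step.hyps(2) adjacent_sym[of G y z] by auto
    show ?thesis
      using True step.IH s leaf by (cases "y = i") (auto split: if_splits)
  next
    case False
    hence "adjacent (induced G (R - {i})) y z" using step.hyps(2) by auto
    with step.IH False show ?thesis by (auto intro: rtranclp.rtrancl_into_rtrancl)
  qed
qed

lemma component_of_remove_leaf:
  assumes leaf: "\<And>v. v \<in> R \<Longrightarrow> adjacent G i v \<Longrightarrow> v = p" and "u \<in> R" "u \<noteq> i"
  shows "component_of (induced G (R - {i})) u = component_of (induced G R) u - {i}"
proof -
  have "(adjacent (induced G R))\<^sup>*\<^sup>* u v" if "(adjacent (induced G (R - {i})))\<^sup>*\<^sup>* u v" for v
    using that by (rule rtranclp_mono[THEN predicate2D, rotated]) auto
  thus ?thesis
    using reach_remove_leaf[of R G i p u] leaf \<open>u \<noteq> i\<close>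
    unfolding component_of_induced by auto
qed

lemma finite_edges_induced: "finite R \<Longrightarrow> finite (edges (induced G R))"
  by (rule finite_subset[of _ "Pow R"]) (auto simp: induced_def)

lemma edges_split:
  assumes "simple_graph G" "i \<in> R"
  shows "edges (induced G R) = edges (induced G (R - {i})) \<union>
           (\<lambda>v. {i, v}) ` {v \<in> R. adjacent G i v}"
proof (intro equalityI subsetI)
  fix e assume e: "e \<in> edges (induced G R)"
  then obtain u v where "e = {u, v}" "u \<noteq> v"
    using assms by (auto simp: simple_graph_def induced_def)
  with e show "e \<in> edges (induced G (R - {i})) \<union> (\<lambda>v. {i, v}) ` {v \<in> R. adjacent G i v}"
    by (cases "i \<in> e") (auto simp: induced_def adjacent_def image_iff insert_commute)
qed (use assms in \<open>auto simp: induced_def adjacent_def\<close>)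

text \<open>This is how the component terms are paid: the last remaining vertex of a component is
  isolated, and the minimum over the component {i} is \<open>c i\<close>.\<close>

lemma forest_cost_remove_isolated:
  assumes sg: "simple_graph G" and fin: "finite R" and i: "i \<in> R"
    and iso: "\<And>v. v \<in> R \<Longrightarrow> \<not> adjacent G i v"
  shows "forest_cost G c R = forest_cost G c (R - {i}) + (c i)\<^sup>2"
proof -
  have E: "edges (induced G R) = edges (induced G (R - {i}))"
    by (subst edges_split[OF sg i]) (use iso in auto)
  have reach: "(adjacent (induced G R))\<^sup>*\<^sup>* i v \<Longrightarrow> v = i" for v
    by (induction rule: rtranclp_induct) (use iso in auto)
  have Ti: "component_of (induced G R) i = {i}"
    using reach i by (auto simp: component_of_induced)
  have Tu: "component_of (induced G (R - {i})) u = component_of (induced G R) u" if "u \<in> R - {i}" for u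
  proof -
    have "i \<notin> component_of (induced G R) u"
      using component_of_eq[of i G R u] Ti component_of_refl[of u R G] that by auto
    \<comment> \<open>Without neighbours the leaf condition is vacuous, so i itself can stand for
      p.\<close>
    thus ?thesis using component_of_remove_leaf[of R G i i u] iso that by auto
  qed
  have C: "component_sets (induced G R) = insert {i} (component_sets (induced G (R - {i})))"
    unfolding component_sets_def verts_induced using i Tu Ti
    by (subst insert_Diff[OF i, symmetric], subst image_insert) (auto simp: image_iff)
  have "{i} \<notin> component_sets (induced G (R - {i}))"
    by (auto simp: component_sets_def component_of_def)
  moreover have "finite (component_sets (induced G (R - {i})))"
    using fin by (simp add: component_sets_def)
  ultimately show ?thesis
    unfolding forest_cost_def E C by simp
qed

text \<open>Deleting a leaf loses one edge but no component: T goes to T - {i}, which is nonempty,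
  and distinct components stay distinct. The witness j keeps the minimum over the component of i, so
  only the edge term changes.\<close>

lemma forest_cost_remove_leaf:
  assumes sg: "simple_graph G" and fin: "finite R" and i: "i \<in> R"
    and p: "p \<in> R" "adjacent G i p"
    and leaf: "\<And>v. v \<in> R \<Longrightarrow> adjacent G i v \<Longrightarrow> v = p"
    and j: "j \<in> R" "j \<noteq> i" "c j \<le> c i" "(adjacent (induced G R))\<^sup>*\<^sup>* i j"
  shows "forest_cost G c R = forest_cost G c (R - {i}) + (c i + c p)\<^sup>2"
proof -
  have ip: "i \<noteq> p" using adjacent_irrefl[OF sg] p by blast
  have N: "{v \<in> R. adjacent G i v} = {p}" by (blast intro: leaf p)
  hence E: "edges (induced G R) = insert {i, p} (edges (induced G (R - {i})))"
    by (subst edges_split[OF sg i]) (simp add: N)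
  have E': "{i, p} \<notin> edges (induced G (R - {i}))" by (auto simp: induced_def)
  have es: "(\<Sum>e\<in>edges (induced G R). (\<Sum>i\<in>e. c i)\<^sup>2) =
      (\<Sum>e\<in>edges (induced G (R - {i})). (\<Sum>i\<in>e. c i)\<^sup>2) + (c i + c p)\<^sup>2"
    unfolding E using E' ip finite_edges_induced[of "R - {i}" G] fin by simp
  let ?C = "component_of (induced G R)"
  have pi: "p \<in> ?C i" using p i by (auto simp: component_of_induced)
  have ji: "j \<in> ?C i" using j i by (auto simp: component_of_induced)
  have "?C p = ?C i" by (rule component_of_eq[OF pi])
  \<comment> \<open>The vertex p represents the component of i, so i can be left out of the index
    set; \<open>component_of_remove_leaf\<close> does not apply to i.\<close>
  hence im: "?C ` R = ?C ` (R - {i})" using p ip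
    by (subst insert_Diff[OF i, symmetric], unfold image_insert) (intro insert_absorb image_eqI[of _ _ p], auto)
  have C: "component_sets (induced G (R - {i})) = (\<lambda>T. T - {i}) ` component_sets (induced G R)"
    unfolding component_sets_def verts_induced im image_image
    by (rule image_cong) (use component_of_remove_leaf[of R G i p] leaf in auto)
  have ne: "T - {i} \<noteq> {}" if T: "T \<in> component_sets (induced G R)" for T
  proof -
    obtain u where u: "u \<in> R" "u \<noteq> i" "T = ?C u"
      using T im by (auto simp: component_sets_def)
    thus ?thesis using component_of_refl[of u R G] by auto
  qed
  have inj: "inj_on (\<lambda>T. T - {i}) (component_sets (induced G R))"
  proof (rule inj_onI)
    fix S T assume ST: "S \<in> component_sets (induced G R)" "T \<in> component_sets (induced G R)"
      "S - {i} = T - {i}"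
    then obtain x where x: "x \<in> S" "x \<in> T" using ne by blast
    obtain u v where "S = ?C u" "T = ?C v" using ST by (auto simp: component_sets_def)
    thus "S = T" using x component_of_eq by metis
  qed
  have M: "Min (c ` (T - {i})) = Min (c ` T)" if T: "T \<in> component_sets (induced G R)" for T
  proof (cases "i \<in> T")
    case True
    obtain u where "T = ?C u" using T by (auto simp: component_sets_def)
    with True have Ti: "T = ?C i" using component_of_eq by metis
    hence jT: "j \<in> T - {i}" using ji j by simp
    have finT: "finite T" using Ti fin by (auto simp: component_of_induced)
    have "c ` T = insert (c i) (c ` (T - {i}))" using True by auto
    hence "Min (c ` T) = min (c i) (Min (c ` (T - {i})))"
      using jT finT by (simp only:) (subst Min_insert, auto)
    moreover have "Min (c ` (T - {i})) \<le> c j" using jT finT by simp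
    ultimately show ?thesis using j by simp
  qed simp
  have "(\<Sum>T\<in>component_sets (induced G (R - {i})). (Min (c ` T))\<^sup>2) =
        (\<Sum>T\<in>component_sets (induced G R). (Min (c ` T))\<^sup>2)"
    unfolding C sum.reindex[OF inj] o_def using M by (intro sum.cong) auto
  thus ?thesis unfolding forest_cost_def es by simp
qed

text \<open>Treats isolated vertices and leaves alike: \<open>N\<close> is empty or a single vertex,
  and \<open>c i + sum c N\<close> is the length of the interval in which the conditional
  expectation will move.\<close>

lemma ex_leaf_removal:
  fixes c :: "'v \<Rightarrow> real"
  assumes sg: "simple_graph G" and fin: "finite R" "R \<noteq> {}"
    and ac: "\<And>q. \<not> is_cycle (induced G R) q"
  obtains i N where "i \<in> R" "N = {v \<in> R. adjacent G i v}" "card N \<le> 1" "i \<notin> N"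
    "forest_cost G c R = forest_cost G c (R - {i}) + (c i + sum c N)\<^sup>2"
proof -
  obtain i where i: "i \<in> R" and alt: "(\<forall>v\<in>R. \<not> adjacent G i v) \<or>
     (\<exists>p\<in>R. \<exists>j\<in>R. adjacent G i p \<and> (\<forall>v\<in>R. adjacent G i v \<longrightarrow> v = p) \<and> j \<noteq> i \<and> c j \<le> c i \<and>
        (adjacent (induced G R))\<^sup>*\<^sup>* i j)"
    using ex_removable_vertex[OF sg fin ac] by blast
  let ?N = "{v \<in> R. adjacent G i v}"
  have iN: "i \<notin> ?N" using adjacent_irrefl[OF sg] by simp
  from alt show thesis
  proof
    assume iso: "\<forall>v\<in>R. \<not> adjacent G i v"
    hence N: "?N = {}" by auto
    show thesis
      by (rule that[OF i refl _ iN]) (use iso in \<open>simp_all add: N forest_cost_remove_isolated[OF sg fin(1) i, of c]\<close>)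
  next
    assume "\<exists>p\<in>R. \<exists>j\<in>R. adjacent G i p \<and> (\<forall>v\<in>R. adjacent G i v \<longrightarrow> v = p) \<and> j \<noteq> i \<and> c j \<le> c i \<and>
        (adjacent (induced G R))\<^sup>*\<^sup>* i j"
    then obtain p j where pj: "p \<in> R" "adjacent G i p" "\<And>v. v \<in> R \<Longrightarrow> adjacent G i v \<Longrightarrow> v = p"
      "j \<in> R" "j \<noteq> i" "c j \<le> c i" "(adjacent (induced G R))\<^sup>*\<^sup>* i j" by blast
    have N: "?N = {p}" by (blast intro: pj)
    show thesis
      by (rule that[OF i refl _ iN]) (use forest_cost_remove_leaf[OF sg fin(1) i pj] in \<open>simp_all add: N\<close>)
  qed
qed

section \<open>Finitely supported graph-dependent vectors\<close>

text \<open>Quantifying over all functions instead of a product of carriers forces f to ignore the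
  coordinates outside \<open>V\<close>, so no restrictions are needed.\<close>

definition hamming_lipschitz :: "('v \<Rightarrow> real) \<Rightarrow> 'v set \<Rightarrow> (('v \<Rightarrow> 'b) \<Rightarrow> real) \<Rightarrow> bool" where
  "hamming_lipschitz c V f \<longleftrightarrow>
     (\<forall>x x'. \<bar>f x - f x'\<bar> \<le> (\<Sum>i\<in>V. c i * of_bool (x i \<noteq> x' i)))"

text \<open>Independence is tested on point events, which determine a discrete joint law. One point
  z serves both sets because they are disjoint. In this form conditioning amounts to a quotient of
  two probabilities.\<close>

definition pmf_dependent :: "'v sgraph \<Rightarrow> 'v set \<Rightarrow> ('v \<Rightarrow> 'b) pmf \<Rightarrow> bool" where
  "pmf_dependent G R p \<longleftrightarrow> (\<forall>S T z. S \<subseteq> R \<and> T \<subseteq> R \<and> S \<inter> T = {} \<and>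
     (\<forall>u\<in>S. \<forall>v\<in>T. \<not> adjacent G u v) \<longrightarrow>
     measure_pmf.prob p {x. \<forall>i\<in>S \<union> T. x i = z i} =
       measure_pmf.prob p {x. \<forall>i\<in>S. x i = z i} * measure_pmf.prob p {x. \<forall>i\<in>T. x i = z i})"

lemma pmf_dependentD:
  assumes "pmf_dependent G R p" "S \<subseteq> R" "T \<subseteq> R" "S \<inter> T = {}"
    and "\<And>u v. u \<in> S \<Longrightarrow> v \<in> T \<Longrightarrow> \<not> adjacent G u v"
  shows "measure_pmf.prob p {x. \<forall>i\<in>S \<union> T. x i = z i} =
    measure_pmf.prob p {x. \<forall>i\<in>S. x i = z i} * measure_pmf.prob p {x. \<forall>i\<in>T. x i = z i}"
  using assms unfolding pmf_dependent_def by simp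

section \<open>Conditioning a finite law on one coordinate\<close>

lemma prob_cond_pmf:
  assumes "set_pmf p \<inter> A \<noteq> {}"
  shows "measure_pmf.prob (cond_pmf p A) B = measure_pmf.prob p (A \<inter> B) / measure_pmf.prob p A"
proof -
  have "emeasure (measure_pmf p) A \<noteq> 0"
    using emeasure_measure_pmf_not_zero[OF assms] .
  thus ?thesis
    unfolding cond_pmf.rep_eq[OF assms]
    by (subst measure_uniform_measure) (auto simp: measure_pmf.emeasure_eq_measure)
qed

text \<open>Having at most one neighbour, i is non-adjacent to all of S or to all of T. If it is T,
  then T is independent of S with i adjoined and also of i alone; dividing the two product formulas
  gives independence under the conditional law.\<close>

lemma pmf_dependent_cond:
  assumes dep: "pmf_dependent G R p" and i: "i \<in> R" and y: "y \<in> (\<lambda>x. x i) ` set_pmf p"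
    and N: "card {v \<in> R. adjacent G i v} \<le> 1" "finite R"
  shows "pmf_dependent G (R - {i}) (cond_pmf p {x. x i = y})"
  unfolding pmf_dependent_def
proof (intro allI impI, elim conjE)
  fix S T :: "'a set" and z
  assume ST: "S \<subseteq> R - {i}" "T \<subseteq> R - {i}" "S \<inter> T = {}" "\<forall>u\<in>S. \<forall>v\<in>T. \<not> adjacent G u v"
  let ?A = "{x. x i = y}" and ?q = "\<lambda>S z. measure_pmf.prob p {x. \<forall>i\<in>S. x i = z i}"
  \<comment> \<open>Writing y into z at i turns the conditioning event into a point event; S and T
    do not contain i and see no difference.\<close>
  define z' where "z' = z(i := y)"
  have ne: "set_pmf p \<inter> ?A \<noteq> {}" using y by auto
  have pos: "measure_pmf.prob p ?A \<noteq> 0" by (rule measure_measure_pmf_not_zero[OF ne])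
  have A: "?A = {x. \<forall>j\<in>{i}. x j = z' j}" by (auto simp: z'_def)
  have q: "measure_pmf.prob (cond_pmf p ?A) {x. \<forall>i\<in>U. x i = z i} = ?q (insert i U) z' / ?q {i} z'"
    if "U \<subseteq> R - {i}" for U
  proof -
    have "?A \<inter> {x. \<forall>i\<in>U. x i = z i} = {x. \<forall>j\<in>insert i U. x j = z' j}"
      using that by (auto simp: z'_def split: if_splits)
    thus ?thesis unfolding prob_cond_pmf[OF ne] by (simp add: A)
  qed
  have indep: "?q (U \<union> W) z' = ?q U z' * ?q W z'"
    if "U \<subseteq> R" "W \<subseteq> R" "U \<inter> W = {}" "\<forall>u\<in>U. \<forall>v\<in>W. \<not> adjacent G u v" for U W
    by (rule pmf_dependentD[OF dep]) (use that in auto)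
  have *: "?q (insert i (U \<union> W)) z' * ?q {i} z' = ?q (insert i U) z' * ?q (insert i W) z'"
    if UW: "U \<subseteq> R - {i}" "W \<subseteq> R - {i}" "U \<inter> W = {}" "\<forall>u\<in>U. \<forall>v\<in>W. \<not> adjacent G u v"
      and nW: "\<forall>v\<in>W. \<not> adjacent G i v" for U W
  proof -
    have "?q (insert i U \<union> W) z' = ?q (insert i U) z' * ?q W z'"
      by (rule indep) (use UW nW i in auto)
    moreover have "?q ({i} \<union> W) z' = ?q {i} z' * ?q W z'"
      by (rule indep) (use UW nW i in auto)
    ultimately show ?thesis by simp
  qed
  have "(\<forall>v\<in>T. \<not> adjacent G i v) \<or> (\<forall>v\<in>S. \<not> adjacent G i v)"
  proof (rule ccontr)
    assume "\<not> ?thesis"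
    then obtain u v where uv: "u \<in> T" "v \<in> S" "adjacent G i u" "adjacent G i v" by blast
    hence "{u, v} \<subseteq> {v \<in> R. adjacent G i v}" "u \<noteq> v" using ST by auto
    hence "card {u, v} \<le> 1" "u \<noteq> v" using N card_mono[of "{v \<in> R. adjacent G i v}" "{u, v}"] by auto
    thus False by simp
  qed
  hence "?q (insert i (S \<union> T)) z' * ?q {i} z' = ?q (insert i S) z' * ?q (insert i T) z'"
  proof
    assume "\<forall>v\<in>T. \<not> adjacent G i v"
    with ST show ?thesis by (intro *)
  next
    assume nS: "\<forall>v\<in>S. \<not> adjacent G i v"
    have "\<forall>u\<in>T. \<forall>v\<in>S. \<not> adjacent G u v" using ST adjacent_sym[of G] by metis
    with ST nS have "?q (insert i (T \<union> S)) z' * ?q {i} z' = ?q (insert i T) z' * ?q (insert i S) z'"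
      by (intro *) auto
    thus ?thesis by (simp add: Un_commute mult.commute)
  qed
  moreover have "?q {i} z' \<noteq> 0" using pos A by simp
  ultimately have "?q (insert i (S \<union> T)) z' / ?q {i} z' =
      ?q (insert i S) z' / ?q {i} z' * (?q (insert i T) z' / ?q {i} z')"
    by (simp add: field_simps)
  thus "measure_pmf.prob (cond_pmf p ?A) {x. \<forall>i\<in>S \<union> T. x i = z i} =
       measure_pmf.prob (cond_pmf p ?A) {x. \<forall>i\<in>S. x i = z i} *
       measure_pmf.prob (cond_pmf p ?A) {x. \<forall>i\<in>T. x i = z i}"
    using ST by (simp add: q)
qed

lemma map_restrict_cond_pmf:
  assumes dep: "pmf_dependent G R p" and i: "i \<in> R" and y: "y \<in> (\<lambda>x. x i) ` set_pmf p"
    and W: "W \<subseteq> R - {i}" "\<forall>v\<in>W. \<not> adjacent G i v"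
  shows "map_pmf (\<lambda>x. restrict x W) (cond_pmf p {x. x i = y}) = map_pmf (\<lambda>x. restrict x W) p"
proof (rule pmf_eqI)
  fix z :: "'a \<Rightarrow> 'b"
  let ?A = "{x. x i = y}"
  have ne: "set_pmf p \<inter> ?A \<noteq> {}" using y by auto
  have pos: "measure_pmf.prob p ?A \<noteq> 0" by (rule measure_measure_pmf_not_zero[OF ne])
  show "pmf (map_pmf (\<lambda>x. restrict x W) (cond_pmf p ?A)) z = pmf (map_pmf (\<lambda>x. restrict x W) p) z"
  proof (cases "z \<in> extensional W")
    case False
    hence "(\<lambda>x. restrict x W) -` {z} = {}" by auto
    thus ?thesis by (simp add: pmf_map)
  next
    case True
    define z' where "z' = z(i := y)"
    have iW: "i \<notin> W" using W by auto
    have v: "(\<lambda>x. restrict x W) -` {z} = {x. \<forall>j\<in>W. x j = z' j}"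
    proof (intro equalityI subsetI)
      fix x assume "x \<in> (\<lambda>x. restrict x W) -` {z}"
      thus "x \<in> {x. \<forall>j\<in>W. x j = z' j}" using iW by (auto simp: z'_def)
    next
      fix x assume "x \<in> {x. \<forall>j\<in>W. x j = z' j}"
      hence "restrict x W = z" using True iW by (intro extensionalityI[of _ W]) (auto simp: z'_def)
      thus "x \<in> (\<lambda>x. restrict x W) -` {z}" by simp
    qed
    have A: "?A = {x. \<forall>j\<in>{i}. x j = z' j}" by (auto simp: z'_def)
    have AW: "?A \<inter> {x. \<forall>j\<in>W. x j = z' j} = {x. \<forall>j\<in>{i} \<union> W. x j = z' j}" by (auto simp: z'_def)
    have "measure_pmf.prob p {x. \<forall>j\<in>{i} \<union> W. x j = z' j} =
      measure_pmf.prob p {x. \<forall>j\<in>{i}. x j = z' j} * measure_pmf.prob p {x. \<forall>j\<in>W. x j = z' j}"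
      by (rule pmf_dependentD[OF dep]) (use W i iW in auto)
    hence "measure_pmf.prob p (?A \<inter> {x. \<forall>j\<in>W. x j = z' j}) =
        measure_pmf.prob p ?A * measure_pmf.prob p {x. \<forall>j\<in>W. x j = z' j}"
      unfolding AW A[symmetric] .
    thus ?thesis unfolding pmf_map v prob_cond_pmf[OF ne] using pos by simp
  qed
qed

section \<open>Tower property and Hoeffding's lemma for finite laws\<close>

lemma expectation_cond_pmf:
  fixes F :: "'a \<Rightarrow> real"
  assumes fin: "finite (set_pmf p)"
  shows "measure_pmf.expectation p F =
    measure_pmf.expectation (map_pmf h p) (\<lambda>y. measure_pmf.expectation (cond_pmf p {x. h x = y}) F)"
proof -
  let ?q = "map_pmf h p"
  have b: "bind_pmf ?q (\<lambda>y. cond_pmf p {x. y = h x}) = p"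
  proof (rule bind_cond_pmf_cancel)
    fix y x assume "y \<in> set_pmf ?q" "x \<in> set_pmf p" "y = h x"
    have "h -` {y. y = h x} = {x'. y = h x'}" using \<open>y = h x\<close> by auto
    thus "measure_pmf.prob p {x. y = h x} = measure_pmf.prob ?q {y. y = h x}" by simp
  qed auto
  have ne: "set_pmf p \<inter> {x. y = h x} \<noteq> {}" if "y \<in> set_pmf ?q" for y using that by auto
  have sym: "{x. h x = y} = {x. y = h x}" for y by auto
  have "measure_pmf.expectation p F = measure_pmf.expectation (bind_pmf ?q (\<lambda>y. cond_pmf p {x. y = h x})) F"
    by (simp only: b)
  also have "\<dots> = (\<Sum>y\<in>set_pmf ?q. pmf ?q y *\<^sub>R measure_pmf.expectation (cond_pmf p {x. y = h x}) F)"
    by (rule pmf_expectation_bind) (use fin ne in auto)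
  also have "\<dots> = measure_pmf.expectation ?q (\<lambda>y. measure_pmf.expectation (cond_pmf p {x. h x = y}) F)"
    unfolding sym by (rule integral_measure_pmf[symmetric]) (use fin in auto)
  finally show ?thesis .
qed

lemma expectation_pmf_mono:
  fixes f g :: "'a \<Rightarrow> real"
  assumes "finite (set_pmf p)" "\<And>x. x \<in> set_pmf p \<Longrightarrow> f x \<le> g x"
  shows "measure_pmf.expectation p f \<le> measure_pmf.expectation p g"
  by (rule integral_mono_AE) (use assms in \<open>auto intro: integrable_measure_pmf_finite simp: AE_measure_pmf_iff\<close>)

text \<open>The mean is kept in the exponent instead of being subtracted, so that the conditional
  mean left by one step can serve as the random variable of the next.\<close>

lemma hoeffding_lemma_pmf:
  fixes f :: "'a \<Rightarrow> real"
  assumes fin: "finite (set_pmf p)" and f: "\<And>x. x \<in> set_pmf p \<Longrightarrow> m \<le> f x \<and> f x \<le> m + a" and s: "s > 0"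
  shows "measure_pmf.expectation p (\<lambda>x. exp (s * f x)) \<le>
    exp (s * measure_pmf.expectation p f + s\<^sup>2 * a\<^sup>2 / 8)"
proof -
  interpret interval_bounded_random_variable "measure_pmf p" f m "m + a"
    by unfold_locales (use f in \<open>auto simp: AE_measure_pmf_iff\<close>)
  let ?E = "measure_pmf.expectation p f"
  have "ennreal (measure_pmf.expectation p (\<lambda>x. exp (s * (f x - ?E)))) =
     (\<integral>\<^sup>+x. exp (s * (f x - ?E)) \<partial>measure_pmf p)"
    by (rule nn_integral_eq_integral[symmetric]) (use fin in \<open>auto intro: integrable_measure_pmf_finite\<close>)
  also have "\<dots> \<le> ennreal (exp (s\<^sup>2 * a\<^sup>2 / 8))"
    using Hoeffdings_lemma_nn_integral[OF s] by simp
  finally have "measure_pmf.expectation p (\<lambda>x. exp (s * (f x - ?E))) \<le> exp (s\<^sup>2 * a\<^sup>2 / 8)"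
    by simp
  hence "exp (s * ?E) * measure_pmf.expectation p (\<lambda>x. exp (s * (f x - ?E))) \<le>
      exp (s * ?E) * exp (s\<^sup>2 * a\<^sup>2 / 8)"
    by (intro mult_left_mono) auto
  also have "exp (s * ?E) * measure_pmf.expectation p (\<lambda>x. exp (s * (f x - ?E))) =
      measure_pmf.expectation p (\<lambda>x. exp (s * f x))"
    by (subst integral_mult_right_zero[symmetric]) (simp add: exp_add[symmetric] algebra_simps)
  finally show ?thesis by (simp add: exp_add)
qed

text \<open>
  Conditioning on a leaf \<open>i\<close> changes neither the dependence structure of the other coordinates nor the
  law of those not adjacent to \<open>i\<close>, so the conditional expectation of \<open>f\<close> varies by at most the
  Lipschitz constants of \<open>i\<close> and its neighbour.
\<close>

lemma cond_expectation_range: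
  fixes f :: "('v \<Rightarrow> 'b) \<Rightarrow> real"
  assumes fin: "finite (set_pmf p)" "finite R" and dep: "pmf_dependent G R p" and i: "i \<in> R"
    and N: "N = {v \<in> R. adjacent G i v}" "i \<notin> N" and lip: "hamming_lipschitz c R f"
    and c: "\<And>j. j \<in> R \<Longrightarrow> 0 \<le> c j"
  shows "\<exists>m. \<forall>y\<in>(\<lambda>x. x i) ` set_pmf p.
     m \<le> measure_pmf.expectation (cond_pmf p {x. x i = y}) f \<and>
     measure_pmf.expectation (cond_pmf p {x. x i = y}) f \<le> m + (c i + sum c N)"
proof -
  define W where "W = R - {i} - N"
  define a where "a = c i + sum c N"
  \<comment> \<open>\<open>g\<close> is the least value of f compatible with the coordinates in
    \<open>W\<close>. Points that agree on \<open>W\<close> differ at most at i and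
    \<open>N\<close>, so f exceeds it by at most \<open>a\<close>.\<close>
  define g where "g = (\<lambda>w. Min (f ` {x \<in> set_pmf p. restrict x W = w}))"
  have g: "g (restrict x W) \<le> f x" "f x \<le> g (restrict x W) + a" if x: "x \<in> set_pmf p" for x
  proof -
    let ?S = "f ` {x' \<in> set_pmf p. restrict x' W = restrict x W}"
    have S: "finite ?S" "?S \<noteq> {}" using fin x by auto
    show "g (restrict x W) \<le> f x" unfolding g_def using S x by (intro Min_le) auto
    have "g (restrict x W) \<in> ?S" unfolding g_def by (rule Min_in[OF S])
    then obtain x' where x': "x' \<in> set_pmf p" "restrict x' W = restrict x W" "g (restrict x W) = f x'"
      by auto
    have eq: "x j = x' j" if "j \<in> W" for j using x'(2) that by (metis restrict_apply')
    have "f x - f x' \<le> (\<Sum>j\<in>R. c j * of_bool (x j \<noteq> x' j))"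
      using lip unfolding hamming_lipschitz_def by (meson abs_le_D1)
    also have "\<dots> = (\<Sum>j\<in>insert i N. c j * of_bool (x j \<noteq> x' j))"
      by (rule sum.mono_neutral_right) (use fin i N eq in \<open>auto simp: W_def\<close>)
    also have "\<dots> \<le> (\<Sum>j\<in>insert i N. c j)"
      by (rule sum_mono) (use c i N in auto)
    also have "\<dots> = a" unfolding a_def using N fin by (subst sum.insert) auto
    finally show "f x \<le> g (restrict x W) + a" using x'(3) by simp
  qed
  \<comment> \<open>The \<open>W\<close>-coordinates have the same law under every conditioning on
    i, which makes this lower end independent of y.\<close>
  define m where "m = measure_pmf.expectation (map_pmf (\<lambda>x. restrict x W) p) g"
  have "m \<le> measure_pmf.expectation (cond_pmf p {x. x i = y}) f \<and>
     measure_pmf.expectation (cond_pmf p {x. x i = y}) f \<le> m + a"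
    if y: "y \<in> (\<lambda>x. x i) ` set_pmf p" for y
  proof -
    let ?py = "cond_pmf p {x. x i = y}"
    have ne: "set_pmf p \<inter> {x. x i = y} \<noteq> {}" using y by auto
    have finy: "finite (set_pmf ?py)" using fin ne by simp
    have sub: "set_pmf ?py \<subseteq> set_pmf p" using ne by simp
    have "map_pmf (\<lambda>x. restrict x W) ?py = map_pmf (\<lambda>x. restrict x W) p"
      by (rule map_restrict_cond_pmf[OF dep i y]) (use N in \<open>auto simp: W_def\<close>)
    hence m: "m = measure_pmf.expectation ?py (\<lambda>x. g (restrict x W))"
      unfolding m_def by (metis integral_map_pmf)
    have "measure_pmf.expectation ?py f \<le> measure_pmf.expectation ?py (\<lambda>x. g (restrict x W) + a)"
      by (rule expectation_pmf_mono[OF finy]) (use g sub in auto)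
    also have "\<dots> = m + a"
      unfolding m by (subst Bochner_Integration.integral_add)
        (use finy in \<open>auto intro: integrable_measure_pmf_finite\<close>)
    moreover have "m \<le> measure_pmf.expectation ?py f"
      unfolding m by (rule expectation_pmf_mono[OF finy]) (use g sub in auto)
    ultimately show ?thesis by simp
  qed
  thus ?thesis unfolding a_def by blast
qed

text \<open>Induction on the number of vertices. Conditioning on a leaf splits the exponential
  moment: the inner part lives on \<open>R - {i}\<close> and is bounded by induction, the outer part
  is the exponential moment of the conditional mean and is bounded by Hoeffding's lemma. The two
  exponents add up by the cost recursion.\<close>

lemma forest_mgf_pmf:
  fixes f :: "('v \<Rightarrow> 'b) \<Rightarrow> real"
  assumes "finite R" "simple_graph G" "\<And>q. \<not> is_cycle (induced G R) q"
    and "\<And>j. j \<in> R \<Longrightarrow> 0 \<le> c j" "finite (set_pmf p)" "pmf_dependent G R p"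
    and "hamming_lipschitz c R f" "s > 0"
  shows "measure_pmf.expectation p (\<lambda>x. exp (s * f x)) \<le>
    exp (s * measure_pmf.expectation p f + s\<^sup>2 * forest_cost G c R / 8)"
  using assms(1,3-7)
proof (induction "card R" arbitrary: R p f)
  case 0
  hence R: "R = {}" by simp
  have D: "forest_cost G c R = 0"
    using assms(2) by (auto simp: R forest_cost_def component_sets_def induced_def simple_graph_def)
  have f: "f x = f undefined" for x
    using 0(7) unfolding R hamming_lipschitz_def by simp
  define r where "r = f undefined"
  have fr: "f x = r" for x unfolding r_def by (rule f)
  show ?case unfolding D fr by simp
next
  case (Suc n)
  note ac = Suc.prems(2) and c = Suc.prems(3) and fin = Suc.prems(4) and dep = Suc.prems(5)
    and lip = Suc.prems(6)
  have "R \<noteq> {}" using Suc(2) by auto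
  then obtain i N where iN: "i \<in> R" "N = {v \<in> R. adjacent G i v}" "card N \<le> 1" "i \<notin> N"
    and cost: "forest_cost G c R = forest_cost G c (R - {i}) + (c i + sum c N)\<^sup>2"
    by (rule ex_leaf_removal[OF assms(2) Suc.prems(1) _ ac, where c = c])
  let ?a = "c i + sum c N" and ?D = "forest_cost G c (R - {i})"
  let ?py = "\<lambda>y. cond_pmf p {x. x i = y}"
  let ?q = "map_pmf (\<lambda>x. x i) p"
  define h where "h y = measure_pmf.expectation (?py y) f" for y
  have step: "measure_pmf.expectation (?py y) (\<lambda>x. exp (s * f x)) \<le> exp (s\<^sup>2 * ?D / 8) * exp (s * h y)"
    if y: "y \<in> set_pmf ?q" for y
  proof -
    have ne: "set_pmf p \<inter> {x. x i = y} \<noteq> {}" using y by auto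
    \<comment> \<open>Freezing coordinate i at y makes the function Lipschitz in the remaining
      coordinates alone, as the induction hypothesis demands, and changes nothing on the support of
      the conditional law.\<close>
    define f' where "f' x = f (x(i := y))" for x
    have f': "f' x = f x" if "x \<in> set_pmf (?py y)" for x
      using that ne by (auto simp: f'_def fun_upd_idem)
    have "measure_pmf.expectation (?py y) (\<lambda>x. exp (s * f' x)) \<le>
      exp (s * measure_pmf.expectation (?py y) f' + s\<^sup>2 * ?D / 8)"
    proof (rule Suc(1))
      show "n = card (R - {i})" using Suc(2) iN Suc.prems(1) by simp
      show "\<not> is_cycle (induced G (R - {i})) q" for q by (rule no_cycle_mono[OF ac]) auto
      show "finite (set_pmf (?py y))" using fin ne by simp
      show "pmf_dependent G (R - {i}) (?py y)"
        by (rule pmf_dependent_cond[OF dep]) (use y iN Suc.prems(1) in auto)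
      show "hamming_lipschitz c (R - {i}) f'"
        unfolding hamming_lipschitz_def
      proof (intro allI)
        fix x x' :: "'v \<Rightarrow> 'b"
        have "\<bar>f' x - f' x'\<bar> \<le> (\<Sum>j\<in>R. c j * of_bool ((x(i := y)) j \<noteq> (x'(i := y)) j))"
          using lip unfolding hamming_lipschitz_def f'_def by blast
        also have "\<dots> = (\<Sum>j\<in>R - {i}. c j * of_bool ((x(i := y)) j \<noteq> (x'(i := y)) j))"
          by (rule sum.mono_neutral_right) (use Suc.prems(1) in auto)
        also have "\<dots> = (\<Sum>j\<in>R - {i}. c j * of_bool (x j \<noteq> x' j))"
          by (rule sum.cong) auto
        finally show "\<bar>f' x - f' x'\<bar> \<le> (\<Sum>j\<in>R - {i}. c j * of_bool (x j \<noteq> x' j))" .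
      qed
    qed (use Suc.prems(1) c in auto)
    moreover have "measure_pmf.expectation (?py y) (\<lambda>x. exp (s * f' x)) =
        measure_pmf.expectation (?py y) (\<lambda>x. exp (s * f x))"
      by (rule integral_cong_AE) (auto simp: AE_measure_pmf_iff f')
    moreover have "measure_pmf.expectation (?py y) f' = h y"
      unfolding h_def by (rule integral_cong_AE) (auto simp: AE_measure_pmf_iff f')
    ultimately show ?thesis by (simp add: exp_add mult.commute)
  qed
  obtain m where m: "\<And>y. y \<in> set_pmf ?q \<Longrightarrow> m \<le> h y \<and> h y \<le> m + ?a"
    using cond_expectation_range[OF fin Suc.prems(1) dep iN(1,2,4) lip c] unfolding h_def by auto
  have finq: "finite (set_pmf ?q)" using fin by simp
  have "measure_pmf.expectation p (\<lambda>x. exp (s * f x)) =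
      measure_pmf.expectation ?q (\<lambda>y. measure_pmf.expectation (?py y) (\<lambda>x. exp (s * f x)))"
    by (rule expectation_cond_pmf[OF fin])
  also have "\<dots> \<le> measure_pmf.expectation ?q (\<lambda>y. exp (s\<^sup>2 * ?D / 8) * exp (s * h y))"
    by (rule expectation_pmf_mono[OF finq step])
  also have "\<dots> = exp (s\<^sup>2 * ?D / 8) * measure_pmf.expectation ?q (\<lambda>y. exp (s * h y))"
    by (rule integral_mult_right_zero)
  also have "\<dots> \<le> exp (s\<^sup>2 * ?D / 8) * exp (s * measure_pmf.expectation ?q h + s\<^sup>2 * ?a\<^sup>2 / 8)"
    by (intro mult_left_mono hoeffding_lemma_pmf[OF finq m assms(8)]) auto
  also have "measure_pmf.expectation ?q h = measure_pmf.expectation p f"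
    unfolding h_def by (rule expectation_cond_pmf[OF fin, symmetric])
  also have "exp (s\<^sup>2 * ?D / 8) * exp (s * measure_pmf.expectation p f + s\<^sup>2 * ?a\<^sup>2 / 8) =
     exp (s * measure_pmf.expectation p f + s\<^sup>2 * forest_cost G c R / 8)"
    unfolding cost by (simp add: exp_add[symmetric] field_simps)
  finally show ?case .
qed

section \<open>Discretization of Hamming-Lipschitz functions\<close>

lemma hamming_lipschitzD:
  "hamming_lipschitz c V f \<Longrightarrow> \<bar>f x - f x'\<bar> \<le> (\<Sum>i\<in>V. c i * of_bool (x i \<noteq> x' i))"
  by (simp add: hamming_lipschitz_def)

lemma hamming_lipschitz_diff_le:
  assumes "hamming_lipschitz c V f" "\<And>i. i \<in> V \<Longrightarrow> 0 \<le> c i"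
  shows "\<bar>f x - f x'\<bar> \<le> sum c V"
proof -
  have "(\<Sum>i\<in>V. c i * of_bool (x i \<noteq> x' i)) \<le> sum c V"
    by (rule sum_mono) (use assms in auto)
  thus ?thesis using hamming_lipschitzD[OF assms(1), of x x'] by simp
qed

text \<open>Lusin's theorem, by inner regularity of the law of \<open>(x, f x)\<close> on the graph of \<open>f\<close>.\<close>

lemma ex_compact_graph:
  fixes N :: "'s::polish_space measure" and f :: "'s \<Rightarrow> real"
  assumes "prob_space N" and sets: "sets N = sets borel" and f: "f \<in> borel_measurable borel"
    and e: "e > 0"
  obtains K where "compact K" "compact ((\<lambda>x. (x, f x)) ` K)" "measure N K > 1 - e"
proof -
  interpret prob_space N by fact
  define g where "g = (\<lambda>x. (x, f x))"
  have fN [measurable]: "f \<in> borel_measurable N" using f sets by (metis measurable_cong_sets)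
  have idN [measurable]: "(\<lambda>x. x) \<in> measurable N borel" using sets by (simp add: measurable_ident_sets)
  have g [measurable]: "g \<in> measurable N borel"
    unfolding g_def by (intro borel_measurable_Pair) measurable
  define \<Gamma> where "\<Gamma> = {z::'s \<times> real. snd z = f (fst z)}"
  have [measurable]: "(\<lambda>z::'s \<times> real. f (fst z)) \<in> borel_measurable borel"
    by (rule measurable_compose[OF _ f]) (intro borel_measurable_continuous_onI continuous_intros)
  have [measurable]: "(snd :: 's \<times> real \<Rightarrow> real) \<in> borel_measurable borel"
    by (intro borel_measurable_continuous_onI continuous_intros)
  have \<Gamma>: "\<Gamma> \<in> sets borel"
  proof -
    have "{z \<in> space borel. (snd :: 's \<times> real \<Rightarrow> real) z = f (fst z)} \<in> sets borel" by measurable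
    thus ?thesis by (simp add: \<Gamma>_def)
  qed
  let ?N' = "distr N borel g"
  interpret N': prob_space ?N' by (rule prob_space_distr) (rule g)
  have "space N = UNIV" using sets_eq_imp_space_eq[OF sets] by simp
  hence "g -` \<Gamma> \<inter> space N = space N" by (auto simp: g_def \<Gamma>_def)
  hence "emeasure ?N' \<Gamma> = 1" using \<Gamma> by (subst emeasure_distr) (auto simp: emeasure_space_1)
  hence "1 = (SUP K\<in>{K. K \<subseteq> \<Gamma> \<and> compact K}. emeasure ?N' K)"
    by (subst inner_regular[symmetric]) (use \<Gamma> N'.emeasure_finite in auto)
  moreover have "ennreal (1 - e) < 1" using e by (simp add: ennreal_less_one_iff)
  ultimately have "ennreal (1 - e) < (SUP K\<in>{K. K \<subseteq> \<Gamma> \<and> compact K}. emeasure ?N' K)" by simp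
  then obtain L where L: "L \<subseteq> \<Gamma>" "compact L" "ennreal (1 - e) < emeasure ?N' L"
    unfolding less_SUP_iff by auto
  \<comment> \<open>The compact piece of the graph is projected. Compactness of the graph over
    \<open>K\<close> stands in for continuity of f there: it gives subsequences along which points
    and values converge together.\<close>
  define K where "K = fst ` L"
  have K: "compact K" unfolding K_def by (intro compact_continuous_image continuous_intros L)
  have gK: "g ` K = L" using L(1) by (force simp: g_def K_def \<Gamma>_def image_iff)
  have LS: "L \<in> sets borel" using L(2) by (simp add: borel_closed compact_imp_closed)
  have "1 - e < measure ?N' L"
    using L(3) by (simp add: N'.emeasure_eq_measure ennreal_less_iff) (smt (verit) e ennreal_less_iff ennreal_neg measure_nonneg not_less ennreal_leI)
  also have "measure ?N' L = measure N (g -` L \<inter> space N)"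
    using LS by (subst measure_distr) auto
  also have "\<dots> \<le> measure N K"
    by (rule finite_measure_mono)
      (use K sets in \<open>auto simp: g_def K_def borel_closed compact_imp_closed intro: rev_image_eqI\<close>)
  finally show thesis using that[OF K] gK L(2) by (simp add: g_def)
qed

text \<open>
  Points of a compact set on which \<open>f\<close> is continuous may be compared by a Hamming distance that
  ignores small changes of a coordinate.
\<close>

lemma hamming_lipschitz_coarse:
  fixes f :: "('i::countable \<Rightarrow> 'b::polish_space) \<Rightarrow> real"
  assumes K: "compact ((\<lambda>x. (x, f x)) ` K)" and V: "finite V" and lip: "hamming_lipschitz c V f"
    and c: "\<And>i. i \<in> V \<Longrightarrow> 0 \<le> c i" and d: "\<delta> > 0"
  shows "\<exists>e>0. \<forall>x\<in>K. \<forall>x'\<in>K. \<bar>f x - f x'\<bar> \<le> (\<Sum>i\<in>V. c i * of_bool (dist (x i) (x' i) \<ge> e)) + \<delta>"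
proof (rule ccontr)
  assume neg: "\<not> ?thesis"
  \<comment> \<open>If no scale works, each scale \<open>1 / Suc m\<close> has a violating pair; the
    contradiction is found at a limit of these pairs.\<close>
  define far where "far m z \<longleftrightarrow> fst z \<in> K \<and> snd z \<in> K \<and>
    \<bar>f (fst z) - f (snd z)\<bar> > (\<Sum>i\<in>V. c i * of_bool (dist (fst z i) (snd z i) \<ge> 1 / Suc m)) + \<delta>" for m :: nat and z
  have "\<exists>z. far m z" for m
  proof -
    have "(0::real) < 1 / Suc m" by simp
    with neg obtain x x' where "x \<in> K" "x' \<in> K"
      "\<not> \<bar>f x - f x'\<bar> \<le> (\<Sum>i\<in>V. c i * of_bool (dist (x i) (x' i) \<ge> 1 / Suc m)) + \<delta>" by blast
    thus ?thesis by (intro exI[of _ "(x, x')"]) (simp add: far_def not_le)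
  qed
  hence "\<exists>w. \<forall>m. far m (w m)" by (intro choice) blast
  then obtain w where w: "\<And>m. far m (w m)" by blast
  define u u' where "u m = fst (w m)" and "u' m = snd (w m)" for m
  have u: "u m \<in> K" "u' m \<in> K"
    "\<bar>f (u m) - f (u' m)\<bar> > (\<Sum>i\<in>V. c i * of_bool (dist (u m i) (u' m i) \<ge> 1 / Suc m)) + \<delta>" for m
    using w[of m] by (simp_all add: far_def u_def u'_def)
  let ?g = "\<lambda>x. (x, f x)"
  have "seq_compact (?g ` K \<times> ?g ` K)"
    using compact_Times[OF K K] by (simp add: compact_eq_seq_compact_metric)
  then obtain l r where l: "l \<in> ?g ` K \<times> ?g ` K" "strict_mono r"
    "((\<lambda>m. (?g (u m), ?g (u' m))) \<circ> r) \<longlonglongrightarrow> l"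
    by (rule seq_compactE[where f = "\<lambda>m. (?g (u m), ?g (u' m))"]) (use u(1,2) in auto)
  obtain y y' where y: "l = (?g y, ?g y')" using l(1) by auto
  have lim: "(\<lambda>m. ?g (u (r m))) \<longlonglongrightarrow> ?g y" "(\<lambda>m. ?g (u' (r m))) \<longlonglongrightarrow> ?g y'"
    using tendsto_fst[OF l(3)] tendsto_snd[OF l(3)] by (simp_all add: y o_def)
  have lims: "(\<lambda>m. u (r m)) \<longlonglongrightarrow> y" "(\<lambda>m. f (u (r m))) \<longlonglongrightarrow> f y"
     "(\<lambda>m. u' (r m)) \<longlonglongrightarrow> y'" "(\<lambda>m. f (u' (r m))) \<longlonglongrightarrow> f y'"
    using tendsto_fst[OF lim(1)] tendsto_snd[OF lim(1)] tendsto_fst[OF lim(2)] tendsto_snd[OF lim(2)]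
    by simp_all
  have coord: "(\<lambda>m. w m i) \<longlonglongrightarrow> z i" if "w \<longlonglongrightarrow> z" for w :: "nat \<Rightarrow> 'i \<Rightarrow> 'b" and z i
    using continuous_on_tendsto_compose[OF continuous_on_product_coordinates that] by simp
  \<comment> \<open>Coordinates in which the limits differ are eventually further apart than the
    vanishing scale. The coarse distance of the pairs is then at least the Hamming distance of their
    limits, and the excess \<delta> survives in the limit.\<close>
  have "eventually (\<lambda>m. y i \<noteq> y' i \<longrightarrow> dist (u (r m) i) (u' (r m) i) \<ge> 1 / Suc (r m)) sequentially" for i
  proof (cases "y i = y' i")
    case False
    have "(\<lambda>m. dist (u (r m) i) (u' (r m) i)) \<longlonglongrightarrow> dist (y i) (y' i)"
      by (intro tendsto_dist coord lims)
    moreover have "(\<lambda>m. 1 / real (Suc (r m))) \<longlonglongrightarrow> 0"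
      using LIMSEQ_subseq_LIMSEQ[OF lim_inverse_n' [THEN LIMSEQ_Suc] l(2)] by (simp add: o_def)
    ultimately have "eventually (\<lambda>m. 0 < dist (u (r m) i) (u' (r m) i) - 1 / real (Suc (r m))) sequentially"
      using False by (intro order_tendstoD(1)[OF tendsto_diff]) auto
    thus ?thesis by eventually_elim auto
  qed simp
  hence "eventually (\<lambda>m. \<forall>i\<in>V. y i \<noteq> y' i \<longrightarrow> dist (u (r m) i) (u' (r m) i) \<ge> 1 / Suc (r m)) sequentially"
    using V by (intro eventually_ball_finite) auto
  hence ev: "eventually (\<lambda>m. \<bar>f y - f y'\<bar> + \<delta> \<le> \<bar>f (u (r m)) - f (u' (r m))\<bar>) sequentially"
  proof eventually_elim
    case (elim m)
    have "\<bar>f y - f y'\<bar> \<le> (\<Sum>i\<in>V. c i * of_bool (y i \<noteq> y' i))"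
      by (rule hamming_lipschitzD[OF lip])
    also have "\<dots> \<le> (\<Sum>i\<in>V. c i * of_bool (dist (u (r m) i) (u' (r m) i) \<ge> 1 / Suc (r m)))"
      by (intro sum_mono mult_left_mono c) (use elim in auto)
    finally show ?case using u(3)[of "r m"] by linarith
  qed
  have "(\<lambda>m. \<bar>f (u (r m)) - f (u' (r m))\<bar>) \<longlonglongrightarrow> \<bar>f y - f y'\<bar>"
    by (intro tendsto_intros lims)
  from tendsto_lowerbound[OF this ev] have "\<bar>f y - f y'\<bar> + \<delta> \<le> \<bar>f y - f y'\<bar>" by simp
  thus False using d by simp
qed

lemma ex_small_cells:
  fixes K :: "'b::polish_space set"
  assumes "compact K" and e: "e > 0"
  obtains \<kappa> :: "'b \<Rightarrow> nat" where "\<kappa> \<in> measurable borel (count_space UNIV)" "finite (range \<kappa>)"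
    "\<And>x y. x \<in> K \<Longrightarrow> y \<in> K \<Longrightarrow> \<kappa> x = \<kappa> y \<Longrightarrow> dist x y < e"
proof -
  have "K \<subseteq> (\<Union>x\<in>K. ball x (e / 2))" using e by auto
  then obtain F where F: "finite F" "K \<subseteq> (\<Union>x\<in>F. ball x (e / 2))"
    by (rule compactE_image[OF assms(1), rotated]) auto
  obtain xs where xs: "set xs = F" using finite_list[OF F(1)] by blast
  \<comment> \<open>\<open>\<kappa>\<close> will number the first ball containing x. The extra
    number \<open>length xs\<close> collects the points in no ball, so that \<open>LEAST\<close>
    always has a witness.\<close>
  define P where "P x k \<longleftrightarrow> k = length xs \<or> (k < length xs \<and> x \<in> ball (xs ! k) (e / 2))" for x k
  define \<kappa> where "\<kappa> x = (LEAST k. P x k)" for x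
  have PK: "P x (\<kappa> x)" for x unfolding \<kappa>_def by (rule LeastI[of _ "length xs"]) (simp add: P_def)
  have rng: "\<kappa> x \<le> length xs" for x using PK[of x] by (auto simp: P_def)
  have lt: "x \<in> ball (xs ! \<kappa> x) (e / 2)" if x: "x \<in> K" for x
  proof -
    obtain a where a: "a \<in> set xs" "x \<in> ball a (e / 2)" using F(2) x xs by blast
    then obtain k where k: "k < length xs" "x \<in> ball (xs ! k) (e / 2)"
      by (auto simp: in_set_conv_nth)
    hence "\<kappa> x \<le> k" unfolding \<kappa>_def by (intro Least_le) (simp add: P_def)
    with k PK[of x] show ?thesis by (auto simp: P_def)
  qed
  show thesis
  proof (rule that[of \<kappa>])
    have "Measurable.pred borel (\<lambda>x. P x k)" for k
    proof -
      have "{x. P x k} = (if k = length xs then UNIV else if k < length xs then ball (xs ! k) (e / 2) else {})"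
        by (auto simp: P_def)
      hence "{x. P x k} \<in> sets borel" by simp
      thus ?thesis by (simp add: pred_def)
    qed
    thus "\<kappa> \<in> measurable borel (count_space UNIV)"
      unfolding \<kappa>_def by (rule measurable_Least)
    show "finite (range \<kappa>)" by (rule finite_subset[of _ "{..length xs}"]) (use rng in auto)
    fix x y assume "x \<in> K" "y \<in> K" "\<kappa> x = \<kappa> y"
    with lt[of x] lt[of y] have "dist (xs ! \<kappa> x) x < e / 2" "dist (xs ! \<kappa> x) y < e / 2" by auto
    thus "dist x y < e" by (smt (verit) dist_commute dist_triangle_half_r)
  qed
qed

text \<open>Within \<open>K\<close>, cells have diameter less than e in each coordinate, so being e
  apart implies lying in different cells; the coarse distance is thus dominated by the Hamming
  distance of cell numbers. Outside \<open>K\<close> only a crude bound is left, which is harmless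
  on a set of small probability.\<close>

lemma ex_discretization:
  fixes N :: "('i::countable \<Rightarrow> 'b::polish_space) measure"
  assumes N: "prob_space N" "sets N = sets borel" and f: "f \<in> borel_measurable borel"
    and V: "finite V" and lip: "hamming_lipschitz c V f" and c: "\<And>i. i \<in> V \<Longrightarrow> 0 \<le> c i"
    and d: "0 < \<delta>" "\<delta> < 1"
  obtains \<kappa> :: "'i \<Rightarrow> 'b \<Rightarrow> nat" and h K where
    "\<And>i. \<kappa> i \<in> measurable borel (count_space UNIV)" "\<And>i. finite (range (\<kappa> i))"
    "hamming_lipschitz c V h" "K \<in> sets borel" "measure N K > 1 - \<delta>"
    "\<And>x. x \<in> K \<Longrightarrow> \<bar>f x - h (\<lambda>i. \<kappa> i (x i))\<bar> \<le> \<delta>"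
    "\<And>x. \<bar>f x - h (\<lambda>i. \<kappa> i (x i))\<bar> \<le> \<delta> + 2 * sum c V"
proof -
  obtain K where K: "compact K" "compact ((\<lambda>x. (x, f x)) ` K)" "measure N K > 1 - \<delta>"
    using ex_compact_graph[OF N f d(1)] by blast
  have "K \<noteq> {}" using K(3) d by auto
  then obtain x0 where x0: "x0 \<in> K" by blast
  obtain e where e: "e > 0" "\<And>x x'. x \<in> K \<Longrightarrow> x' \<in> K \<Longrightarrow>
      \<bar>f x - f x'\<bar> \<le> (\<Sum>i\<in>V. c i * of_bool (dist (x i) (x' i) \<ge> e)) + \<delta>"
    using hamming_lipschitz_coarse[OF K(2) V lip c d(1)] by blast
  have "\<exists>k :: 'b \<Rightarrow> nat. k \<in> measurable borel (count_space UNIV) \<and> finite (range k) \<and>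
    (\<forall>x\<in>(\<lambda>x. x i) ` K. \<forall>y\<in>(\<lambda>x. x i) ` K. k x = k y \<longrightarrow> dist x y < e)" for i
  proof -
    have "compact ((\<lambda>x. x i) ` K)"
      by (rule compact_continuous_image[OF _ K(1)])
        (rule continuous_on_subset[OF continuous_on_product_coordinates], simp)
    from ex_small_cells[OF this e(1)] show ?thesis by metis
  qed
  then obtain \<kappa> :: "'i \<Rightarrow> 'b \<Rightarrow> nat" where \<kappa>: "\<And>i. \<kappa> i \<in> measurable borel (count_space UNIV)"
    "\<And>i. finite (range (\<kappa> i))"
    "\<And>i x y. x \<in> K \<Longrightarrow> y \<in> K \<Longrightarrow> \<kappa> i (x i) = \<kappa> i (y i) \<Longrightarrow> dist (x i) (y i) < e"
    by (metis imageI)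
  let ?k = "\<lambda>x i. \<kappa> i (x i)"
  define D where "D z w = (\<Sum>i\<in>V. c i * of_bool (z i \<noteq> w i))" for z w :: "'i \<Rightarrow> nat"
  have D_ge0: "0 \<le> D z w" for z w unfolding D_def by (intro sum_nonneg mult_nonneg_nonneg c) auto
  have D_tri: "D z w \<le> D z v + D v w" for z w v
    unfolding D_def sum.distrib[symmetric] distrib_left[symmetric]
    by (intro sum_mono mult_left_mono c) auto
  have D_sym: "D z w = D w z" for z w unfolding D_def by (simp add: eq_commute)
  \<comment> \<open>McShane's formula on cell numbers. At the cells of a point x of
    \<open>K\<close>, the competitor x itself gives at most \<open>f x\<close>, and by the choice of
    e no other competitor goes below \<open>f x - \<delta>\<close>.\<close>
  define h where "h z = (INF x\<in>K. f x + D z (?k x))" for z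
  have flb: "f x0 - sum c V \<le> f x" for x
    using hamming_lipschitz_diff_le[OF lip c, of x x0] by linarith
  have bdd: "bdd_below ((\<lambda>x. f x + D z (?k x)) ` K)" for z
    by (rule bdd_belowI2[of _ "f x0 - sum c V"]) (use flb D_ge0 in \<open>smt (verit)\<close>)
  have h_le: "h z \<le> h w + D z w" for z w
  proof -
    have "h z - D z w \<le> h w"
      unfolding h_def[of w]
    proof (rule cINF_greatest)
      show "K \<noteq> {}" by fact
      fix x assume x: "x \<in> K"
      have "h z \<le> f x + D z (?k x)" unfolding h_def by (rule cINF_lower[OF bdd x])
      thus "h z - D z w \<le> f x + D w (?k x)" using D_tri[of z "?k x" w] by linarith
    qed
    thus ?thesis by simp
  qed
  have lip_h: "hamming_lipschitz c V h"
    unfolding hamming_lipschitz_def using h_le D_sym by (auto simp: D_def[symmetric] abs_le_iff algebra_simps)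
      (metis add.commute)
  have onK: "\<bar>f x - h (?k x)\<bar> \<le> \<delta>" if x: "x \<in> K" for x
  proof -
    have "h (?k x) \<le> f x + D (?k x) (?k x)" unfolding h_def by (rule cINF_lower[OF bdd x])
    also have "D (?k x) (?k x) = 0" by (simp add: D_def)
    finally have "h (?k x) \<le> f x" by simp
    moreover have "f x - \<delta> \<le> h (?k x)"
      unfolding h_def
    proof (rule cINF_greatest)
      show "K \<noteq> {}" by fact
      fix x' assume x': "x' \<in> K"
      have "(\<Sum>i\<in>V. c i * of_bool (dist (x i) (x' i) \<ge> e)) \<le> D (?k x) (?k x')"
        unfolding D_def
      proof (intro sum_mono mult_left_mono c)
        fix i
        show "(of_bool (dist (x i) (x' i) \<ge> e) :: real) \<le> of_bool (?k x i \<noteq> ?k x' i)"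
          using \<kappa>(3)[OF x x', of i] by (auto simp: of_bool_def)
      qed
      thus "f x - \<delta> \<le> f x' + D (?k x) (?k x')" using e(2)[OF x x'] by linarith
    qed
    ultimately show ?thesis by linarith
  qed
  \<comment> \<open>Both functions vary by at most \<open>sum c V\<close> overall, so closeness at
    the one point \<open>x0\<close> bounds the error everywhere.\<close>
  have "\<bar>f x - h (?k x)\<bar> \<le> \<delta> + 2 * sum c V" for x
    using onK[OF x0] hamming_lipschitz_diff_le[OF lip c, of x x0]
      hamming_lipschitz_diff_le[OF lip_h c, of "?k x" "?k x0"] by linarith
  moreover have "K \<in> sets borel" using K(1) by (simp add: borel_closed compact_imp_closed)
  ultimately show thesis using that[of \<kappa> h K] \<kappa>(1,2) lip_h K(3) onK by blast
qed

text \<open>Boxes suffice as test events: prescribing the cells of some coordinates is a box, and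
  the discretized law is queried on nothing else.\<close>

definition box_dependent :: "'i sgraph \<Rightarrow> 'i set \<Rightarrow> ('i \<Rightarrow> 'b::topological_space) measure \<Rightarrow> bool" where
  "box_dependent G V N \<longleftrightarrow> (\<forall>S T A. S \<subseteq> V \<and> T \<subseteq> V \<and> S \<inter> T = {} \<and>
     (\<forall>u\<in>S. \<forall>v\<in>T. \<not> adjacent G u v) \<and> (\<forall>i. A i \<in> sets borel) \<longrightarrow>
     measure N {x. \<forall>i\<in>S \<union> T. x i \<in> A i} =
       measure N {x. \<forall>i\<in>S. x i \<in> A i} * measure N {x. \<forall>i\<in>T. x i \<in> A i})"

lemma (in prob_space) ex_pmf_distr:
  assumes fin: "finite (range Y)" and Y: "\<And>z. Y -` {z} \<inter> space M \<in> sets M"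
  obtains p where "Y \<in> measurable M (count_space UNIV)" "measure_pmf p = distr M (count_space UNIV) Y"
    "set_pmf p \<subseteq> range Y"
proof -
  have meas: "Y \<in> measurable M (count_space UNIV)"
  proof (rule measurableI)
    fix A
    have "Y -` A \<inter> space M = (\<Union>z\<in>A \<inter> range Y. Y -` {z} \<inter> space M)" by auto
    also have "\<dots> \<in> sets M" using fin Y by (intro sets.finite_UN) auto
    finally show "Y -` A \<inter> space M \<in> sets M" .
  qed auto
  let ?D = "distr M (count_space UNIV) Y"
  interpret D: prob_space ?D by (rule prob_space_distr[OF meas])
  have R: "AE z in ?D. z \<in> range Y" by (subst AE_distr_iff[OF meas]) auto
  have "AE z in ?D. measure ?D {z} \<noteq> 0"
    using fin R by (subst D.AE_support_countable) (auto intro: countable_finite)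
  hence D: "measure_pmf (Abs_pmf ?D) = ?D"
    by (intro Abs_pmf_inverse) (auto intro: D.prob_space_axioms)
  have "AE z in measure_pmf (Abs_pmf ?D). z \<in> range Y" unfolding D by (rule R)
  hence "set_pmf (Abs_pmf ?D) \<subseteq> range Y" by (simp only: AE_measure_pmf_iff subset_eq)
  with meas D show thesis by (rule that)
qed

text \<open>Each cell number is a function of its own coordinate only, so the discretized vector
  inherits the dependence structure and the finite case applies to it. The error is at most \<delta>
  on \<open>K\<close> and bounded off \<open>K\<close>, which has probability at most
  \<delta>.\<close>

lemma forest_mgf_polish:
  fixes N :: "('i::countable \<Rightarrow> 'b::polish_space) measure"
  assumes N: "prob_space N" "sets N = sets borel" and f: "f \<in> borel_measurable borel"
    and V: "finite V" and lip: "hamming_lipschitz c V f" and c: "\<And>i. i \<in> V \<Longrightarrow> 0 \<le> c i"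
    and G: "simple_graph G" "\<And>q. \<not> is_cycle (induced G V) q"
    and dep: "box_dependent G V N" and s: "s > 0"
  shows "(\<integral>x. exp (s * f x) \<partial>N) \<le> exp (s * (\<integral>x. f x \<partial>N) + s\<^sup>2 * forest_cost G c V / 8)"
proof -
  interpret prob_space N by fact
  define C B b E where "C = sum c V" and "B = forest_cost G c V" and "b = \<bar>f undefined\<bar> + C"
    and "E = (\<integral>x. f x \<partial>N)"
  have sp: "space N = UNIV" using sets_eq_imp_space_eq[OF N(2)] by simp
  have fN [measurable]: "f \<in> borel_measurable N" using f N(2) by (metis measurable_cong_sets)
  have C: "C \<ge> 0" unfolding C_def using c by (rule sum_nonneg)
  have fb: "\<bar>f x\<bar> \<le> b" for x
    using hamming_lipschitz_diff_le[OF lip c, of x undefined] unfolding b_def C_def by linarith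
  have intf: "integrable N f" by (rule integrable_const_bound[of _ b]) (use fb in auto)
  have intef: "integrable N (\<lambda>x. exp (s * f x))"
    by (rule integrable_const_bound[of _ "exp (s * b)"]) (use fb s in \<open>auto simp: abs_le_iff\<close>)
  \<comment> \<open>Three errors are collected: the factor \<open>exp (s * \<delta>)\<close> comes
    from comparing f with its discretization on \<open>K\<close>, the terms added to
    \<open>E\<close> bound the change of the mean, and the last summand is the contribution of the
    complement of \<open>K\<close>.\<close>
  define \<phi> where "\<phi> \<delta> = exp (s * \<delta>) * exp (s * (E + \<delta> + (\<delta> + 2 * C) * \<delta>) + s\<^sup>2 * B / 8) + \<delta> * exp (s * b)"
    for \<delta>
  have main: "(\<integral>x. exp (s * f x) \<partial>N) \<le> \<phi> \<delta>" if d: "0 < \<delta>" "\<delta> < 1" for \<delta>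
  proof -
    obtain \<kappa> :: "'i \<Rightarrow> 'b \<Rightarrow> nat" and h K where
      \<kappa>: "\<And>i. \<kappa> i \<in> measurable borel (count_space UNIV)" "\<And>i. finite (range (\<kappa> i))"
      and h: "hamming_lipschitz c V h" and K: "K \<in> sets borel" "measure N K > 1 - \<delta>"
      and onK: "\<And>x. x \<in> K \<Longrightarrow> \<bar>f x - h (\<lambda>i. \<kappa> i (x i))\<bar> \<le> \<delta>"
      and all: "\<And>x. \<bar>f x - h (\<lambda>i. \<kappa> i (x i))\<bar> \<le> \<delta> + 2 * C"
      unfolding C_def using ex_discretization[OF N f V lip c d] by blast
    \<comment> \<open>The constant 0 outside \<open>V\<close> keeps the range finite;
      \<open>h\<close> ignores these coordinates.\<close>
    define Y where "Y x i = (if i \<in> V then \<kappa> i (x i) else 0)" for x :: "'i \<Rightarrow> 'b" and i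
    define g where "g x = h (Y x)" for x
    have g: "g x = h (\<lambda>i. \<kappa> i (x i))" for x
    proof -
      have "(\<Sum>i\<in>V. c i * of_bool (Y x i \<noteq> \<kappa> i (x i))) = 0"
        by (rule sum.neutral) (auto simp: Y_def)
      thus ?thesis
        using hamming_lipschitzD[OF h, of "Y x" "\<lambda>i. \<kappa> i (x i)"] by (simp add: g_def)
    qed
    have coord: "{x. \<forall>i\<in>S. x i \<in> A i} \<in> sets N" if "S \<subseteq> V" "\<And>i. A i \<in> sets borel" for S A
    proof -
      have "{x. x i \<in> A i} \<in> sets borel" for i
        using measurable_sets[OF borel_measurable_continuous_onI[OF continuous_on_product_coordinates[of i]] that(2)[of i]]
        by (simp add: vimage_def)
      hence "(\<Inter>i\<in>S. {x. x i \<in> A i}) \<in> sets borel" if "S \<noteq> {}"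
        using that \<open>S \<subseteq> V\<close> V by (intro sets.finite_INT) (auto intro: finite_subset)
      moreover have "{x. \<forall>i\<in>S. x i \<in> A i} = (\<Inter>i\<in>S. {x. x i \<in> A i})" by auto
      ultimately show ?thesis unfolding N(2) by (cases "S = {}") auto
    qed
    have \<kappa>s: "\<kappa> i -` {k} \<in> sets borel" for i k using measurable_sets[OF \<kappa>(1), of "{k}" i] by simp
    have "finite (PiE_dflt V 0 (\<lambda>i. range (\<kappa> i)))"
      using V \<kappa>(2) by (intro finite_PiE_dflt) auto
    moreover have "range Y \<subseteq> PiE_dflt V 0 (\<lambda>i. range (\<kappa> i))" by (auto simp: Y_def PiE_dflt_def)
    ultimately have finY: "finite (range Y)" by (rule rev_finite_subset)
    have "Y -` {z} \<inter> space N \<in> sets N" for z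
    proof (cases "\<forall>i. i \<notin> V \<longrightarrow> z i = 0")
      case True
      hence "Y -` {z} \<inter> space N = {x. \<forall>i\<in>V. x i \<in> \<kappa> i -` {z i}}"
        by (auto simp: Y_def fun_eq_iff sp)
      thus ?thesis by (simp only:) (intro coord \<kappa>s subset_refl)
    next
      case False
      hence "Y -` {z} = {}" by (auto simp: Y_def fun_eq_iff)
      thus ?thesis by simp
    qed
    then obtain p where Y [measurable]: "Y \<in> measurable N (count_space UNIV)"
      and p: "measure_pmf p = distr N (count_space UNIV) Y" "set_pmf p \<subseteq> range Y"
      using ex_pmf_distr[OF finY] by blast
    have Ep: "measure_pmf.expectation p F = (\<integral>x. F (Y x) \<partial>N)" for F :: "_ \<Rightarrow> real"
      unfolding p by (rule integral_distr) auto
    have gN [measurable]: "g \<in> borel_measurable N" unfolding g_def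
      by (rule measurable_compose[OF Y]) simp
    have pr: "measure_pmf.prob p {y. \<forall>i\<in>S. y i = z i} = measure N {x. \<forall>i\<in>S. x i \<in> \<kappa> i -` {z i}}"
      if "S \<subseteq> V" for S z
      unfolding p by (subst measure_distr)
        (use that in \<open>auto simp: sp Y_def subset_iff intro!: arg_cong[of _ _ "measure N"]\<close>)
    have "measure_pmf.expectation p (\<lambda>x. exp (s * h x)) \<le>
        exp (s * measure_pmf.expectation p h + s\<^sup>2 * B / 8)"
      unfolding B_def
    proof (rule forest_mgf_pmf[OF V G c _ _ h s])
      show "finite (set_pmf p)" using p(2) finY finite_subset by blast
      show "pmf_dependent G V p"
        unfolding pmf_dependent_def
      proof (intro allI impI, elim conjE)
        fix S T z assume ST: "S \<subseteq> V" "T \<subseteq> V" "S \<inter> T = {}" "\<forall>u\<in>S. \<forall>v\<in>T. \<not> adjacent G u v"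
        hence "S \<union> T \<subseteq> V" by simp
        have "measure N {x. \<forall>i\<in>S \<union> T. x i \<in> \<kappa> i -` {z i}} =
          measure N {x. \<forall>i\<in>S. x i \<in> \<kappa> i -` {z i}} * measure N {x. \<forall>i\<in>T. x i \<in> \<kappa> i -` {z i}}"
          using dep[unfolded box_dependent_def, rule_format, of S T "\<lambda>i. \<kappa> i -` {z i}"] ST \<kappa>s by blast
        thus "measure_pmf.prob p {x. \<forall>i\<in>S \<union> T. x i = z i} =
          measure_pmf.prob p {x. \<forall>i\<in>S. x i = z i} * measure_pmf.prob p {x. \<forall>i\<in>T. x i = z i}"
          unfolding pr[OF ST(1)] pr[OF ST(2)] pr[OF \<open>S \<union> T \<subseteq> V\<close>] .
      qed
    qed
    hence mgf: "(\<integral>x. exp (s * g x) \<partial>N) \<le> exp (s * (\<integral>x. g x \<partial>N) + s\<^sup>2 * B / 8)"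
      unfolding Ep g_def .
    have KN [measurable]: "K \<in> sets N" using K N by simp
    have measK: "measure N (- K) \<le> \<delta>"
      using K(2) prob_compl[OF KN] by (simp add: sp Compl_eq_Diff_UNIV)
    have cK [measurable]: "- K \<in> sets N" using KN sp by (metis Compl_eq_Diff_UNIV sets.compl_sets)
    have gf: "g x \<le> f x + \<delta> + (\<delta> + 2 * C) * indicator (- K) x" for x
      using onK[of x] all[of x] d C by (auto simp: g indicator_def)
    have gb: "\<bar>g x\<bar> \<le> b + (\<delta> + 2 * C)" for x using all[of x] fb[of x] unfolding g by linarith
    have intg: "integrable N g" by (rule integrable_const_bound[of _ "b + (\<delta> + 2 * C)"]) (use gb in auto)
    have integ: "integrable N (\<lambda>x. exp (s * g x))"
      by (rule integrable_const_bound[of _ "exp (s * (b + (\<delta> + 2 * C)))"])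
        (use gb s in \<open>auto simp: abs_le_iff\<close>)
    have intK: "integrable N (\<lambda>x. indicator (- K) x :: real)"
      by (rule integrable_const_bound[of _ 1]) auto
    have "(\<integral>x. g x \<partial>N) \<le> (\<integral>x. f x + \<delta> + (\<delta> + 2 * C) * indicator (- K) x \<partial>N)"
      by (rule integral_mono[OF intg _ gf]) (use intf intK in auto)
    also have "\<dots> = E + \<delta> + (\<delta> + 2 * C) * measure N (- K)"
      using intf intK sp prob_space by (simp add: E_def)
    also have "\<dots> \<le> E + \<delta> + (\<delta> + 2 * C) * \<delta>"
      using measK C d by (intro add_left_mono mult_left_mono) auto
    finally have Eg: "(\<integral>x. g x \<partial>N) \<le> E + \<delta> + (\<delta> + 2 * C) * \<delta>" .
    have ef: "exp (s * f x) \<le> exp (s * \<delta>) * exp (s * g x) + exp (s * b) * indicator (- K) x" for x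
    proof (cases "x \<in> K")
      case True
      hence "s * f x \<le> s * (\<delta> + g x)" using onK[of x] s unfolding g by (intro mult_left_mono) auto
      thus ?thesis using True by (simp add: exp_add[symmetric] distrib_left)
    next
      case False
      have "exp (s * f x) \<le> exp (s * b)" using fb[of x] s by (auto simp: abs_le_iff)
      thus ?thesis using False by (simp add: add_increasing)
    qed
    have "(\<integral>x. exp (s * f x) \<partial>N) \<le>
        (\<integral>x. exp (s * \<delta>) * exp (s * g x) + exp (s * b) * indicator (- K) x \<partial>N)"
      by (rule integral_mono[OF intef _ ef]) (use integ intK in auto)
    also have "\<dots> = exp (s * \<delta>) * (\<integral>x. exp (s * g x) \<partial>N) + exp (s * b) * measure N (- K)"
      using integ intK sp by simp
    also have "\<dots> \<le> exp (s * \<delta>) * exp (s * (E + \<delta> + (\<delta> + 2 * C) * \<delta>) + s\<^sup>2 * B / 8) + exp (s * b) * \<delta>"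
    proof (intro add_mono mult_left_mono measK)
      have "exp (s * (\<integral>x. g x \<partial>N) + s\<^sup>2 * B / 8) \<le> exp (s * (E + \<delta> + (\<delta> + 2 * C) * \<delta>) + s\<^sup>2 * B / 8)"
        using Eg s by simp
      with mgf show "(\<integral>x. exp (s * g x) \<partial>N) \<le> exp (s * (E + \<delta> + (\<delta> + 2 * C) * \<delta>) + s\<^sup>2 * B / 8)"
        by linarith
    qed auto
    finally show ?thesis by (simp add: \<phi>_def mult.commute)
  qed
  have "(\<phi> \<longlongrightarrow> exp (s * E + s\<^sup>2 * B / 8)) (at_right 0)"
    unfolding \<phi>_def by (auto intro!: tendsto_eq_intros)
  moreover have "eventually (\<lambda>\<delta>. (\<integral>x. exp (s * f x) \<partial>N) \<le> \<phi> \<delta>) (at_right 0)"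
    using eventually_at_right_real[of 0 "1::real"] by (rule eventually_mono) (use main in auto)
  ultimately show ?thesis
    unfolding E_def B_def by (rule tendsto_lowerbound) simp
qed

section \<open>Embedding Polish spaces\<close>

lemma sets_borel_top: "sets (borel_top X) = sigma_sets (topspace X) {U. openin X U}"
  unfolding borel_top_def by (rule sets_measure_of) (auto dest: openin_subset)

lemma space_borel_top [simp]: "space (borel_top X) = topspace X"
  unfolding borel_top_def by (rule space_measure_of) (auto dest: openin_subset)

lemma gdelta_in_euclidean_borel:
  assumes "gdelta_in euclidean (S :: 'b::topological_space set)"
  shows "S \<in> sets borel"
proof -
  obtain \<U> where \<U>: "countable \<U>" "\<U> \<subseteq> Collect (openin euclidean)" "S = \<Inter>\<U>"
    using assms unfolding gdelta_in_alt intersection_of_def by auto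
  show ?thesis
  proof (cases "\<U> = {}")
    case False
    have "(\<Inter>U\<in>\<U>. U) \<in> sets borel"
      using \<U>(1,2) False by (intro sets.countable_INT') auto
    thus ?thesis using \<U>(3) by simp
  qed (use \<U> in simp)
qed

text \<open>Distances to a dense sequence separate points and recover the topology, so \<phi> is a
  homeomorphism onto its image. The image is completely metrizable, hence a G-delta set and Borel.
  Therefore the inverse, extended by a fixed point \<open>x0\<close> off the image, is
  measurable.\<close>

lemma polish_embedding:
  fixes X :: "'a topology"
  assumes X: "polish_top X" and ne: "topspace X \<noteq> {}"
  obtains \<phi> :: "'a \<Rightarrow> nat \<Rightarrow> real" and \<psi> where "\<phi> \<in> measurable (borel_top X) borel"
    "\<psi> \<in> measurable borel (borel_top X)" "\<And>x. x \<in> topspace X \<Longrightarrow> \<psi> (\<phi> x) = x"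
proof -
  obtain M d where md: "Metric_space M d" "Metric_space.mcomplete M d" "X = Metric_space.mtopology M d"
    using X unfolding polish_top_def completely_metrizable_space_def by blast
  interpret Metric_space M d by fact
  have top: "topspace X = M" using md(3) by simp
  obtain C where C: "countable C" "C \<subseteq> M" "X closure_of C = M"
    using X top unfolding polish_top_def separable_space_def by auto
  have "C \<noteq> {}" using C(3) ne top by auto
  define a where "a = from_nat_into C"
  have aC: "range a = C" unfolding a_def by (rule range_from_nat_into[OF \<open>C \<noteq> {}\<close> C(1)])
  have aM: "a n \<in> M" for n using aC C(2) by auto
  have dense: "\<exists>n. d x (a n) < r" if "x \<in> M" "r > 0" for x r
  proof -
    have "x \<in> X closure_of C" using that C by simp
    moreover have "openin X (mball x r)" "x \<in> mball x r" using that md(3) by auto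
    ultimately obtain y where "y \<in> C" "y \<in> mball x r" unfolding in_closure_of by blast
    thus ?thesis using aC by auto
  qed
  define \<phi> where "\<phi> x n = d x (a n)" for x n
  have cont: "continuous_map X euclidean \<phi>"
  proof -
    have "continuous_map X euclideanreal (\<lambda>x. \<phi> x n)" for n
    proof -
      have aX: "a n \<in> topspace X" using aM top by simp
      have X: "mtopology_of (metric (M, d)) = X" by (simp add: mtopology_of_def md(3))
      have "continuous_map X euclideanreal (\<lambda>x. mdist (metric (M, d)) x (a n))"
        by (rule continuous_map_mdist; unfold X) (use aX in simp_all)
      thus ?thesis by (simp add: \<phi>_def)
    qed
    thus ?thesis
      unfolding euclidean_product_topology[symmetric] by (simp add: continuous_map_componentwise_UNIV)
  qed
  \<comment> \<open>Each point of \<open>U\<close> lies in a ball around some \<open>a n\<close>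
    inside \<open>U\<close>, and such a ball corresponds to a half-space \<open>y n < q\<close>. The
    formula is used twice: \<phi> is open onto its image, and images of open sets are Borel.\<close>
  have img: "\<phi> ` U = \<phi> ` M \<inter> (\<Union>(n, q)\<in>{(n, q). mball (a n) q \<subseteq> U}. {y. y n < q})"
    if U: "openin X U" for U
  proof (intro equalityI subsetI)
    fix y assume "y \<in> \<phi> ` U"
    then obtain x where x: "x \<in> U" "y = \<phi> x" by blast
    have xM: "x \<in> M" using x U openin_subset top by blast
    obtain r where r: "r > 0" "mball x r \<subseteq> U"
      using U x unfolding md(3) openin_mtopology by blast
    obtain n where n: "d x (a n) < r / 2" using dense[OF xM, of "r / 2"] r by auto
    have "mball (a n) (r / 2) \<subseteq> mball x r"
    proof
      fix z assume z: "z \<in> mball (a n) (r / 2)"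
      have "d x z \<le> d x (a n) + d (a n) z" using xM aM z by (intro triangle) auto
      thus "z \<in> mball x r" using z n xM by auto
    qed
    hence "(n, r / 2) \<in> {(n, q). mball (a n) q \<subseteq> U}" using r by auto
    moreover have "y \<in> {y. y n < r / 2}" using n by (simp add: x \<phi>_def)
    ultimately show "y \<in> \<phi> ` M \<inter> (\<Union>(n, q)\<in>{(n, q). mball (a n) q \<subseteq> U}. {y. y n < q})"
      using x xM by blast
  next
    fix y assume "y \<in> \<phi> ` M \<inter> (\<Union>(n, q)\<in>{(n, q). mball (a n) q \<subseteq> U}. {y. y n < q})"
    then obtain x n q where x: "x \<in> M" "y = \<phi> x" "mball (a n) q \<subseteq> U" "d x (a n) < q"
      by (auto simp: \<phi>_def)
    hence "x \<in> mball (a n) q" using aM commute by auto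
    thus "y \<in> \<phi> ` U" using x by blast
  qed
  have op: "open (\<Union>(n, q)\<in>{(n, q). mball (a n) q \<subseteq> U}. {y :: nat \<Rightarrow> real. y n < q})" for U
    by (intro open_UN ballI) (auto intro!: open_Collect_less continuous_intros)
  have inj: "inj_on \<phi> M"
  proof (rule inj_onI, rule ccontr)
    fix x y assume xy: "x \<in> M" "y \<in> M" "\<phi> x = \<phi> y" "x \<noteq> y"
    hence "d x y > 0" by simp
    then obtain n where n: "d x (a n) < d x y / 2" using dense[OF xy(1), of "d x y / 2"] by auto
    have "d y (a n) = d x (a n)" using fun_cong[OF xy(3), of n] by (simp add: \<phi>_def)
    moreover have "d x y \<le> d x (a n) + d (a n) y" using xy aM by (intro triangle) auto
    ultimately show False using n commute[of "a n" y] by simp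
  qed
  have "homeomorphic_map X (subtopology euclidean (\<phi> ` M)) \<phi>"
  proof (rule bijective_open_imp_homeomorphic_map)
    show "continuous_map X (top_of_set (\<phi> ` M)) \<phi>"
      using cont top by (auto simp: continuous_map_in_subtopology)
    show "open_map X (top_of_set (\<phi> ` M)) \<phi>"
      unfolding open_map_def openin_open
    proof (intro allI impI)
      fix U assume "openin X U"
      show "\<exists>T. open T \<and> \<phi> ` U = \<phi> ` M \<inter> T"
        by (rule exI, rule conjI, rule op[of U], rule img) fact
    qed
  qed (use top inj in auto)
  hence "completely_metrizable_space (subtopology euclidean (\<phi> ` M))"
    using X homeomorphic_completely_metrizable_space homeomorphic_map_imp_homeomorphic_space
    unfolding polish_top_def by blast
  hence "gdelta_in euclidean (\<phi> ` M)"
    by (intro completely_metrizable_space_imp_gdelta_in) (auto simp: metrizable_space_euclidean)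
  hence imB: "\<phi> ` M \<in> sets borel" by (rule gdelta_in_euclidean_borel)
  obtain x0 where x0: "x0 \<in> M" using ne top by blast
  define \<psi> where "\<psi> y = (if y \<in> \<phi> ` M then inv_into M \<phi> y else x0)" for y
  have \<psi>\<phi>: "\<psi> (\<phi> x) = x" if "x \<in> M" for x using that inj by (simp add: \<psi>_def)
  have \<psi>M: "\<psi> y \<in> M" for y using x0 by (auto simp: \<psi>_def inv_into_into)
  show thesis
  proof (rule that)
    show "\<phi> \<in> measurable (borel_top X) borel"
    proof (rule borel_measurableI)
      fix S :: "(nat \<Rightarrow> real) set" assume "open S"
      hence "openin X {x \<in> topspace X. \<phi> x \<in> S}" using cont by (simp add: continuous_map_def)
      moreover have "\<phi> -` S \<inter> space (borel_top X) = {x \<in> topspace X. \<phi> x \<in> S}" by auto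
      ultimately show "\<phi> -` S \<inter> space (borel_top X) \<in> sets (borel_top X)"
        unfolding sets_borel_top by (auto intro: sigma_sets.Basic)
    qed
    show "\<psi> \<in> measurable borel (borel_top X)"
      unfolding borel_top_def
    proof (rule measurable_measure_of)
      fix U assume "U \<in> {U. openin X U}"
      hence U: "openin X U" by simp
      have "\<psi> -` U = \<phi> ` U \<union> (if x0 \<in> U then - \<phi> ` M else {})"
      proof -
        have "U \<subseteq> M" using openin_subset[OF U] top by simp
        have in_im: "\<psi> y \<in> U \<longleftrightarrow> y \<in> \<phi> ` U" if y: "y \<in> \<phi> ` M" for y
        proof -
          obtain x where x: "x \<in> M" "y = \<phi> x" using y by blast
          show ?thesis unfolding x(2) \<psi>\<phi>[OF x(1)] inj_on_image_mem_iff[OF inj x(1) \<open>U \<subseteq> M\<close>] ..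
        qed
        have off: "\<psi> y = x0" if "y \<notin> \<phi> ` M" for y using that by (simp add: \<psi>_def)
        have sub: "\<phi> ` U \<subseteq> \<phi> ` M" using \<open>U \<subseteq> M\<close> by (rule image_mono)
        show ?thesis
        proof (rule set_eqI)
          fix y
          show "y \<in> \<psi> -` U \<longleftrightarrow> y \<in> \<phi> ` U \<union> (if x0 \<in> U then - \<phi> ` M else {})"
          proof (cases "y \<in> \<phi> ` M")
            case True
            thus ?thesis using in_im[OF True] by simp
          next
            case False
            hence "y \<notin> \<phi> ` U" using sub by blast
            thus ?thesis using False off[OF False] by simp
          qed
        qed
      qed
      moreover have "\<phi> ` U \<in> sets borel"
        unfolding img[OF U] by (rule sets.Int[OF imB borel_open[OF op]])
      ultimately show "\<psi> -` U \<inter> space borel \<in> sets borel" using imB by auto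
    qed (use \<psi>M top openin_subset in auto)
    show "\<psi> (\<phi> x) = x" if "x \<in> topspace X" for x using \<psi>\<phi> that top by simp
  qed
qed

section \<open>Moment generating functions on forests\<close>

lemma lipschitz_coordD:
  "lipschitz_coord \<Omega> c V g \<Longrightarrow> x \<in> PiE V (\<lambda>i. topspace (\<Omega> i)) \<Longrightarrow> x' \<in> PiE V (\<lambda>i. topspace (\<Omega> i)) \<Longrightarrow>
    \<bar>g x - g x'\<bar> \<le> (\<Sum>i\<in>V. c i * of_bool (x i \<noteq> x' i))"
  by (simp add: lipschitz_coord_def)

lemma space_prod_space: "space (prod_space \<Omega> V) = PiE V (\<lambda>i. topspace (\<Omega> i))"
  by (simp add: prod_space_def space_PiM)

text \<open>The variables are moved into one Polish type by the embeddings, and g is pulled back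
  along their left inverses. Maps applied coordinatewise never increase a Hamming distance and
  preserve independence, so both hypotheses carry over.\<close>

lemma forest_mgf:
  fixes \<Omega> :: "'i::countable \<Rightarrow> 'a topology"
  assumes M: "prob_space M" and X: "X \<in> measurable M (prod_space \<Omega> (verts G))"
    and dep: "graph_dependent M \<Omega> G X" and polish: "\<And>i. i \<in> verts G \<Longrightarrow> polish_top (\<Omega> i)"
    and G: "simple_graph G" and F: "F \<subseteq> verts G" "is_forest (induced G F)"
    and c: "\<And>i. i \<in> F \<Longrightarrow> 0 \<le> c i" and g: "g \<in> borel_measurable (prod_space \<Omega> F)"
    and lip: "lipschitz_coord \<Omega> c F g" and s: "s > 0"
  shows "(\<integral>\<omega>. exp (s * g (restrict (X \<omega>) F)) \<partial>M) \<le>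
     exp (s * (\<integral>\<omega>. g (restrict (X \<omega>) F) \<partial>M) + s\<^sup>2 * forest_cost G c F / 8)"
proof -
  interpret prob_space M by fact
  have finF: "finite F" using G F finite_subset by (auto simp: simple_graph_def)
  \<comment> \<open>One value of \<open>X\<close> shows that the spaces are nonempty, as the
    embedding requires.\<close>
  obtain \<omega>0 where \<omega>0: "\<omega>0 \<in> space M" using not_empty by blast
  have Xi: "(\<lambda>\<omega>. X \<omega> i) \<in> measurable M (borel_top (\<Omega> i))" if "i \<in> verts G" for i
    using measurable_compose[OF X[unfolded prod_space_def] measurable_component_singleton[OF that]] .
  have "\<exists>\<phi> \<psi>. \<phi> \<in> measurable (borel_top (\<Omega> i)) (borel :: (nat \<Rightarrow> real) measure) \<and>
     \<psi> \<in> measurable borel (borel_top (\<Omega> i)) \<and> (\<forall>x\<in>topspace (\<Omega> i). \<psi> (\<phi> x) = x)" if "i \<in> F" for i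
  proof -
    have "X \<omega>0 i \<in> topspace (\<Omega> i)" using measurable_space[OF Xi \<omega>0] that F by auto
    hence "topspace (\<Omega> i) \<noteq> {}" by blast
    moreover have "polish_top (\<Omega> i)" using polish that F by blast
    ultimately show ?thesis using polish_embedding[of "\<Omega> i"] by metis
  qed
  hence "\<exists>\<phi>. \<forall>i\<in>F. \<exists>\<psi>. \<phi> i \<in> measurable (borel_top (\<Omega> i)) (borel :: (nat \<Rightarrow> real) measure) \<and>
     \<psi> \<in> measurable borel (borel_top (\<Omega> i)) \<and> (\<forall>x\<in>topspace (\<Omega> i). \<psi> (\<phi> i x) = x)"
    by (intro bchoice) auto
  then obtain \<phi> where "\<forall>i\<in>F. \<exists>\<psi>. \<phi> i \<in> measurable (borel_top (\<Omega> i)) (borel :: (nat \<Rightarrow> real) measure) \<and>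
     \<psi> \<in> measurable borel (borel_top (\<Omega> i)) \<and> (\<forall>x\<in>topspace (\<Omega> i). \<psi> (\<phi> i x) = x)" ..
  from bchoice[OF this] obtain \<psi> where e: "\<forall>i\<in>F. \<phi> i \<in> measurable (borel_top (\<Omega> i)) (borel :: (nat \<Rightarrow> real) measure) \<and>
     \<psi> i \<in> measurable borel (borel_top (\<Omega> i)) \<and> (\<forall>x\<in>topspace (\<Omega> i). \<psi> i (\<phi> i x) = x)" ..
  have \<phi>: "\<phi> i \<in> measurable (borel_top (\<Omega> i)) borel" and \<psi>: "\<psi> i \<in> measurable borel (borel_top (\<Omega> i))"
    and \<psi>\<phi>: "x \<in> topspace (\<Omega> i) \<Longrightarrow> \<psi> i (\<phi> i x) = x" if "i \<in> F" for i x
    using e that by auto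
  \<comment> \<open>\<open>Z\<close> takes values in the full function type, which is Polish since
    the index type is countable; coordinates outside \<open>F\<close> are filled with a
    constant.\<close>
  define Z where "Z \<omega> i = (if i \<in> F then \<phi> i (X \<omega> i) else undefined)" for \<omega> i
  define f where "f x = g (\<lambda>i\<in>F. \<psi> i (x i))" for x
  have Z [measurable]: "Z \<in> measurable M borel"
  proof (rule measurable_coordinatewise_then_product)
    fix i
    show "(\<lambda>\<omega>. Z \<omega> i) \<in> borel_measurable M"
      unfolding Z_def using measurable_compose[OF Xi \<phi>, of i] F by (cases "i \<in> F") auto
  qed
  have f [measurable]: "f \<in> borel_measurable borel"
    unfolding f_def
  proof (rule measurable_compose[OF _ g], unfold prod_space_def, rule measurable_restrict)
    fix i assume i: "i \<in> F"
    show "(\<lambda>x. \<psi> i (x i)) \<in> measurable borel (borel_top (\<Omega> i))"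
      by (rule measurable_compose[OF _ \<psi>[OF i]])
        (rule borel_measurable_continuous_onI[OF continuous_on_product_coordinates])
  qed
  let ?N = "distr M borel Z"
  have fZ: "f (Z \<omega>) = g (restrict (X \<omega>) F)" if "\<omega> \<in> space M" for \<omega>
  proof -
    have "(\<lambda>i\<in>F. \<psi> i (Z \<omega> i)) = restrict (X \<omega>) F"
      by (rule restrict_ext) (use measurable_space[OF Xi that] F \<psi>\<phi> in \<open>auto simp: Z_def\<close>)
    thus ?thesis by (simp add: f_def)
  qed
  have lip': "hamming_lipschitz c F f"
    unfolding hamming_lipschitz_def
  proof (intro allI)
    fix x x' :: "'i \<Rightarrow> nat \<Rightarrow> real"
    have mem: "(\<lambda>i\<in>F. \<psi> i (x i)) \<in> PiE F (\<lambda>i. topspace (\<Omega> i))" for x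
      using measurable_space[OF \<psi>] by auto
    have "\<bar>f x - f x'\<bar> \<le> (\<Sum>i\<in>F. c i * of_bool ((\<lambda>i\<in>F. \<psi> i (x i)) i \<noteq> (\<lambda>i\<in>F. \<psi> i (x' i)) i))"
      unfolding f_def by (rule lipschitz_coordD[OF lip mem mem])
    also have "\<dots> \<le> (\<Sum>i\<in>F. c i * of_bool (x i \<noteq> x' i))"
      by (intro sum_mono mult_left_mono c) (auto simp: of_bool_def)
    finally show "\<bar>f x - f x'\<bar> \<le> (\<Sum>i\<in>F. c i * of_bool (x i \<noteq> x' i))" .
  qed
  have box: "box_dependent G F ?N"
    unfolding box_dependent_def
  proof (intro allI impI, elim conjE)
    fix S T :: "'i set" and A :: "'i \<Rightarrow> (nat \<Rightarrow> real) set"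
    assume ST: "S \<subseteq> F" "T \<subseteq> F" "S \<inter> T = {}" "\<forall>u\<in>S. \<forall>v\<in>T. \<not> adjacent G u v"
      and A: "\<forall>i. A i \<in> sets borel"
    define B where "B U = PiE U (\<lambda>i. \<phi> i -` A i \<inter> topspace (\<Omega> i))" for U
    have B: "B U \<in> sets (prod_space \<Omega> U)" if "U \<subseteq> F" for U
      unfolding B_def prod_space_def
    proof (rule sets_PiM_I_finite)
      show "finite U" using that finF finite_subset by blast
      fix i assume "i \<in> U"
      thus "\<phi> i -` A i \<inter> topspace (\<Omega> i) \<in> sets (borel_top (\<Omega> i))"
        using measurable_sets[OF \<phi>, of i "A i"] A that by auto
    qed
    have ev: "Z -` {x. \<forall>i\<in>U. x i \<in> A i} \<inter> space M = {\<omega> \<in> space M. restrict (X \<omega>) U \<in> B U}"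
      if "U \<subseteq> F" for U
    proof -
      have "X \<omega> i \<in> topspace (\<Omega> i)" if "\<omega> \<in> space M" "i \<in> U" for \<omega> i
        using measurable_space[OF Xi] that \<open>U \<subseteq> F\<close> F by auto
      thus ?thesis using that unfolding B_def restrict_PiE_iff by (auto simp: Z_def subset_iff)
    qed
    have bs: "{x. \<forall>i\<in>U. x i \<in> A i} \<in> sets borel" if "U \<subseteq> F" for U
    proof -
      have "{x. x i \<in> A i} \<in> sets borel" for i
        using measurable_sets[OF borel_measurable_continuous_onI[OF continuous_on_product_coordinates[of i]], of "A i"] A
        by (simp add: vimage_def)
      hence "(\<Inter>i\<in>U. {x. x i \<in> A i}) \<in> sets borel" if "U \<noteq> {}"
        using that \<open>U \<subseteq> F\<close> finF by (intro sets.finite_INT) (auto intro: finite_subset)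
      moreover have "{x. \<forall>i\<in>U. x i \<in> A i} = (\<Inter>i\<in>U. {x. x i \<in> A i})" by auto
      ultimately show ?thesis by (cases "U = {}") auto
    qed
    have m: "measure ?N {x. \<forall>i\<in>U. x i \<in> A i} = prob {\<omega> \<in> space M. restrict (X \<omega>) U \<in> B U}"
      if "U \<subseteq> F" for U
      using bs[OF that] ev[OF that] by (subst measure_distr) auto
    have STF: "S \<union> T \<subseteq> F" using ST by simp
    have "indep_var (prod_space \<Omega> S) (\<lambda>\<omega>. restrict (X \<omega>) S) (prod_space \<Omega> T) (\<lambda>\<omega>. restrict (X \<omega>) T)"
      by (rule dep[unfolded graph_dependent_def, rule_format]) (use ST F in blast)
    from indep_varD[OF this B[OF ST(1)] B[OF ST(2)]]
    have "prob ((\<lambda>\<omega>. (restrict (X \<omega>) S, restrict (X \<omega>) T)) -` (B S \<times> B T) \<inter> space M) =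
      prob {\<omega> \<in> space M. restrict (X \<omega>) S \<in> B S} * prob {\<omega> \<in> space M. restrict (X \<omega>) T \<in> B T}"
      by (simp add: vimage_def Int_def conj_commute)
    moreover have "(\<lambda>\<omega>. (restrict (X \<omega>) S, restrict (X \<omega>) T)) -` (B S \<times> B T) \<inter> space M =
        {\<omega> \<in> space M. restrict (X \<omega>) (S \<union> T) \<in> B (S \<union> T)}"
    proof -
      have pt: "restrict (X \<omega>) U \<in> B U \<longleftrightarrow> (\<forall>i\<in>U. Z \<omega> i \<in> A i)" if "\<omega> \<in> space M" "U \<subseteq> F" for \<omega> U
        using ev[OF that(2)] that(1) by blast
      show ?thesis using pt[OF _ ST(1)] pt[OF _ ST(2)] pt[OF _ STF] by auto
    qed
    ultimately show "measure ?N {x. \<forall>i\<in>S \<union> T. x i \<in> A i} =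
        measure ?N {x. \<forall>i\<in>S. x i \<in> A i} * measure ?N {x. \<forall>i\<in>T. x i \<in> A i}"
      unfolding m[OF ST(1)] m[OF ST(2)] m[OF STF] by simp
  qed
  have "(\<integral>x. exp (s * f x) \<partial>?N) \<le> exp (s * (\<integral>x. f x \<partial>?N) + s\<^sup>2 * forest_cost G c F / 8)"
    by (rule forest_mgf_polish[OF prob_space_distr[OF Z] _ f finF lip' c G forest_no_cycle[OF F(2)] box s]) auto
  also have "(\<integral>x. f x \<partial>?N) = (\<integral>\<omega>. g (restrict (X \<omega>) F) \<partial>M)"
    by (subst integral_distr) (auto intro!: Bochner_Integration.integral_cong simp: fZ)
  also have "(\<integral>x. exp (s * f x) \<partial>?N) = (\<integral>\<omega>. exp (s * g (restrict (X \<omega>) F)) \<partial>M)"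
    by (subst integral_distr) (auto intro!: Bochner_Integration.integral_cong simp: fZ)
  finally show ?thesis .
qed

section \<open>Combining the members of a cover\<close>

lemma FFC_D:
  assumes "C \<in> FFC G" "k < length C"
  shows "fst (C ! k) \<subseteq> verts G" "0 \<le> snd (C ! k)" "is_forest (induced G (fst (C ! k)))"
  using assms nth_mem[OF assms(2)] unfolding FFC_def fractional_cover_def
  by (auto simp: case_prod_beta)

lemma FFC_sum:
  assumes "C \<in> FFC G" "v \<in> verts G"
  shows "(\<Sum>k | k < length C \<and> v \<in> fst (C ! k). snd (C ! k)) = 1"
  using assms unfolding FFC_def fractional_cover_def by auto

lemma forest_cost_nonneg: "0 \<le> forest_cost G c F"
  unfolding forest_cost_def by (intro add_nonneg_nonneg sum_nonneg) auto

lemma cover_cost_eq: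
  "cover_cost G c C = (\<Sum>k<length C. snd (C ! k) * sqrt (forest_cost G c (fst (C ! k))))\<^sup>2"
  unfolding cover_cost_def forest_cost_def ..

lemma lipschitz_coord_diff_le:
  assumes "lipschitz_coord \<Omega> c V g" "\<And>i. i \<in> V \<Longrightarrow> 0 \<le> c i"
    and "x \<in> PiE V (\<lambda>i. topspace (\<Omega> i))" "x' \<in> PiE V (\<lambda>i. topspace (\<Omega> i))"
  shows "\<bar>g x - g x'\<bar> \<le> sum c V"
proof -
  have "(\<Sum>i\<in>V. c i * of_bool (x i \<noteq> x' i)) \<le> sum c V"
    by (rule sum_mono) (use assms in auto)
  thus ?thesis using lipschitz_coordD[OF assms(1,3,4)] by simp
qed

text \<open>Convexity needs no information on the joint behaviour of the members: only their
  separate exponential moments enter. The increment \<epsilon> keeps every \<open>r k\<close>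
  positive, as the exponents \<open>q k\<close> divide by it.\<close>

lemma cover_tail_bound:
  fixes \<Omega> :: "'i::countable \<Rightarrow> 'a topology"
  assumes M: "prob_space M" and X: "X \<in> measurable M (prod_space \<Omega> (verts G))"
    and dep: "graph_dependent M \<Omega> G X" and polish: "\<And>i. i \<in> verts G \<Longrightarrow> polish_top (\<Omega> i)"
    and G: "simple_graph G" "verts G \<noteq> {}"
    and c: "\<And>i. i \<in> verts G \<Longrightarrow> 0 \<le> c i" and f: "forest_decomposable \<Omega> c G f"
    and C: "C \<in> FFC G" and t: "t > 0" and e: "\<epsilon> > 0"
  defines "R \<equiv> (\<Sum>k<length C. snd (C ! k) * (sqrt (forest_cost G c (fst (C ! k))) + \<epsilon>))"
  shows "\<P>(\<omega> in M. f (X \<omega>) - (\<integral>\<omega>'. f (X \<omega>') \<partial>M) \<ge> t) \<le> exp (- (2 * t\<^sup>2 / R\<^sup>2))" and "R > 0"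
proof -
  interpret prob_space M by fact
  define m F w D r where "m = length C" and "F k = fst (C ! k)" and "w k = snd (C ! k)"
    and "D k = forest_cost G c (F k)" and "r k = sqrt (D k) + \<epsilon>" for k
  note defs = m_def F_def w_def D_def r_def
  have R: "R = (\<Sum>k<m. w k * r k)" by (simp add: R_def defs)
  have F: "F k \<subseteq> verts G" and w: "0 \<le> w k" and forest: "is_forest (induced G (F k))" if "k < m" for k
    using FFC_D[OF C] that by (auto simp: defs)
  have D: "0 \<le> D k" for k unfolding D_def by (rule forest_cost_nonneg)
  have r: "0 < r k" for k unfolding r_def using D[of k] e by (simp add: add_nonneg_pos)
  \<comment> \<open>The members containing any one vertex already have total weight 1, so
    \<open>R\<close> is at least \<epsilon>.\<close>
  obtain v where v: "v \<in> verts G" using G(2) by blast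
  have "1 = (\<Sum>k | k < m \<and> v \<in> F k. w k)" using FFC_sum[OF C v] by (simp add: defs)
  also have "\<dots> \<le> (\<Sum>k<m. w k)" by (rule sum_mono2) (use w in auto)
  finally have "0 < \<epsilon> * (\<Sum>k<m. w k)" using e by simp
  also have "\<dots> \<le> R"
    unfolding R sum_distrib_left using w D by (intro sum_mono) (simp add: r_def algebra_simps)
  finally show Rpos: "R > 0" .
  obtain g where g: "\<And>k. k < m \<Longrightarrow> g k \<in> borel_measurable (prod_space \<Omega> (F k))"
      "\<And>k. k < m \<Longrightarrow> lipschitz_coord \<Omega> c (F k) (g k)"
    and fg: "\<And>x. x \<in> PiE (verts G) (\<lambda>i. topspace (\<Omega> i)) \<Longrightarrow> f x = (\<Sum>k<m. w k * g k (restrict x (F k)))"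
  proof -
    obtain g where "(\<forall>k<length C. g k \<in> borel_measurable (prod_space \<Omega> (fst (C ! k))) \<and>
          lipschitz_coord \<Omega> c (fst (C ! k)) (g k)) \<and>
        (\<forall>x\<in>PiE (verts G) (\<lambda>i. topspace (\<Omega> i)).
           f x = (\<Sum>k<length C. snd (C ! k) * g k (restrict x (fst (C ! k)))))"
      using bspec[OF f[unfolded forest_decomposable_def] C] ..
    thus thesis by (intro that[of g]) (simp_all add: defs)
  qed
  define h where "h k \<omega> = g k (restrict (X \<omega>) (F k))" for k \<omega>
  have Xsp: "X \<omega> \<in> PiE (verts G) (\<lambda>i. topspace (\<Omega> i))" if "\<omega> \<in> space M" for \<omega>
    using measurable_space[OF X that] by (simp add: space_prod_space)
  have Xk: "restrict (X \<omega>) (F k) \<in> PiE (F k) (\<lambda>i. topspace (\<Omega> i))" if "\<omega> \<in> space M" "k < m" for \<omega> k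
    using Xsp[OF that(1)] F[OF that(2)] by auto
  have h [measurable]: "h k \<in> borel_measurable M" if "k < m" for k
    unfolding h_def
    using measurable_compose[OF measurable_compose[OF X[unfolded prod_space_def] measurable_restrict_subset[OF F[OF that]]]
        g(1)[OF that, unfolded prod_space_def]] .
  obtain \<omega>0 where \<omega>0: "\<omega>0 \<in> space M" using not_empty by blast
  define b where "b k = \<bar>h k \<omega>0\<bar> + sum c (F k)" for k
  have hb: "\<bar>h k \<omega>\<bar> \<le> b k" if "\<omega> \<in> space M" "k < m" for \<omega> k
  proof -
    have "\<bar>h k \<omega> - h k \<omega>0\<bar> \<le> sum c (F k)"
      unfolding h_def
      by (rule lipschitz_coord_diff_le[OF g(2)[OF that(2)] _ Xk[OF that] Xk[OF \<omega>0 that(2)]])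
        (use c F[OF that(2)] in auto)
    thus ?thesis unfolding b_def by linarith
  qed
  have inth: "integrable M (h k)" if "k < m" for k
    by (rule integrable_const_bound[of _ "b k"]) (use hb h that in auto)
  define \<mu> where "\<mu> k = (\<integral>\<omega>. h k \<omega> \<partial>M)" for k
  define Y where "Y \<omega> = (\<Sum>k<m. w k * (h k \<omega> - \<mu> k))" for \<omega>
  have fX: "f (X \<omega>) = (\<Sum>k<m. w k * h k \<omega>)" if "\<omega> \<in> space M" for \<omega>
    using fg[OF Xsp[OF that]] by (simp add: h_def)
  have "(\<integral>\<omega>. f (X \<omega>) \<partial>M) = (\<integral>\<omega>. (\<Sum>k<m. w k * h k \<omega>) \<partial>M)"
    by (rule Bochner_Integration.integral_cong) (simp_all add: fX)
  also have "\<dots> = (\<Sum>k<m. w k * \<mu> k)"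
    unfolding \<mu>_def using inth by (subst Bochner_Integration.integral_sum) auto
  finally have Y: "f (X \<omega>) - (\<integral>\<omega>'. f (X \<omega>') \<partial>M) = Y \<omega>" if "\<omega> \<in> space M" for \<omega>
    unfolding Y_def by (simp add: fX[OF that] right_diff_distrib sum_subtractf)
  have [measurable]: "Y \<in> borel_measurable M" unfolding Y_def using h by (auto intro!: borel_measurable_sum)
  define B where "B = (\<Sum>k<m. w k * (b k + \<bar>\<mu> k\<bar>))"
  have YB: "\<bar>Y \<omega>\<bar> \<le> B" if \<omega>: "\<omega> \<in> space M" for \<omega>
    unfolding Y_def B_def
  proof (rule order_trans[OF sum_abs], rule sum_mono)
    fix k assume "k \<in> {..<m}"
    hence "\<bar>h k \<omega> - \<mu> k\<bar> \<le> b k + \<bar>\<mu> k\<bar>" "0 \<le> w k" using hb[OF \<omega>, of k] w[of k] by auto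
    thus "\<bar>w k * (h k \<omega> - \<mu> k)\<bar> \<le> w k * (b k + \<bar>\<mu> k\<bar>)" by (simp add: abs_mult mult_left_mono)
  qed
  \<comment> \<open>The minimizer of \<open>- s * t + s\<^sup>2 * R\<^sup>2 / 8\<close>.\<close>
  define s where "s = 4 * t / R\<^sup>2"
  have s: "s > 0" unfolding s_def using t Rpos by simp
  \<comment> \<open>Since \<open>p k * q k = s * w k\<close>, the exponent
    \<open>s * Y \<omega>\<close> is a convex combination of the scaled centred members; since
    \<open>q k * r k = s * R\<close>, they all obey the same bound.\<close>
  define p where "p k = w k * r k / R" for k
  define q where "q k = s * R / r k" for k
  have q: "q k > 0" for k unfolding q_def using s Rpos r by simp
  have p0: "p k \<ge> 0" if "k < m" for k unfolding p_def using w[OF that] r[of k] Rpos by simp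
  have p1: "(\<Sum>k<m. p k) = 1"
    unfolding p_def sum_divide_distrib[symmetric] R[symmetric] using Rpos by simp
  have m0: "{..<m} \<noteq> {}" using p1 by (intro notI) simp
  have mgf: "(\<integral>\<omega>. exp (q k * (h k \<omega> - \<mu> k)) \<partial>M) \<le> exp (s\<^sup>2 * R\<^sup>2 / 8)" if k: "k < m" for k
  proof -
    have "(\<integral>\<omega>. exp (q k * h k \<omega>) \<partial>M) \<le> exp (q k * \<mu> k + (q k)\<^sup>2 * D k / 8)"
      unfolding h_def \<mu>_def D_def
      by (rule forest_mgf[OF M X dep polish G(1) F[OF k] forest[OF k] _ g(1)[OF k] g(2)[OF k] q])
        (use c F[OF k] in auto)
    hence "exp (- q k * \<mu> k) * (\<integral>\<omega>. exp (q k * h k \<omega>) \<partial>M) \<le>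
        exp (- q k * \<mu> k) * exp (q k * \<mu> k + (q k)\<^sup>2 * D k / 8)"
      by (intro mult_left_mono) auto
    also have "exp (- q k * \<mu> k) * (\<integral>\<omega>. exp (q k * h k \<omega>) \<partial>M) = (\<integral>\<omega>. exp (q k * (h k \<omega> - \<mu> k)) \<partial>M)"
      by (subst integral_mult_right_zero[symmetric]) (simp add: exp_add[symmetric] algebra_simps)
    also have "exp (- q k * \<mu> k) * exp (q k * \<mu> k + (q k)\<^sup>2 * D k / 8) = exp ((q k)\<^sup>2 * D k / 8)"
      by (simp add: exp_add[symmetric])
    also have "\<dots> \<le> exp (s\<^sup>2 * R\<^sup>2 / 8)"
    proof -
      have "D k = (sqrt (D k))\<^sup>2" using D by simp
      also have "\<dots> \<le> (r k)\<^sup>2" unfolding r_def using e D by (intro power_mono) auto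
      finally have "(q k)\<^sup>2 * D k \<le> (q k)\<^sup>2 * (r k)\<^sup>2" by (intro mult_left_mono) auto
      also have "\<dots> = s\<^sup>2 * R\<^sup>2" unfolding q_def using r[of k] by (simp add: power_divide power_mult_distrib)
      finally show ?thesis by simp
    qed
    finally show ?thesis .
  qed
  have inte: "integrable M (\<lambda>\<omega>. exp (q k * (h k \<omega> - \<mu> k)))" if k: "k < m" for k
  proof (rule integrable_const_bound[of _ "exp (q k * (b k + \<bar>\<mu> k\<bar>))"])
    show "AE \<omega> in M. norm (exp (q k * (h k \<omega> - \<mu> k))) \<le> exp (q k * (b k + \<bar>\<mu> k\<bar>))"
    proof (rule AE_I2)
      fix \<omega> assume \<omega>: "\<omega> \<in> space M"
      have "q k * (h k \<omega> - \<mu> k) \<le> q k * (b k + \<bar>\<mu> k\<bar>)"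
        using q[of k] hb[OF \<omega> k] by (intro mult_left_mono) (auto simp: abs_le_iff)
      thus "norm (exp (q k * (h k \<omega> - \<mu> k))) \<le> exp (q k * (b k + \<bar>\<mu> k\<bar>))" by simp
    qed
    show "(\<lambda>\<omega>. exp (q k * (h k \<omega> - \<mu> k))) \<in> borel_measurable M" using h[OF k] by measurable
  qed
  have inteY: "integrable M (\<lambda>\<omega>. exp (s * Y \<omega>))"
  proof (rule integrable_const_bound[of _ "exp (s * B)"])
    show "AE \<omega> in M. norm (exp (s * Y \<omega>)) \<le> exp (s * B)"
      by (rule AE_I2) (use YB s in \<open>auto simp: abs_le_iff\<close>)
  qed measurable
  have conv: "exp (s * Y \<omega>) \<le> (\<Sum>k<m. p k * exp (q k * (h k \<omega> - \<mu> k)))" for \<omega>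
  proof -
    have "s * Y \<omega> = (\<Sum>k<m. p k *\<^sub>R (q k * (h k \<omega> - \<mu> k)))"
      unfolding Y_def sum_distrib_left
    proof (rule sum.cong)
      fix k
      have "p k * q k = s * w k" unfolding p_def q_def using r[of k] Rpos by simp
      thus "s * (w k * (h k \<omega> - \<mu> k)) = p k *\<^sub>R (q k * (h k \<omega> - \<mu> k))"
        by (simp add: mult.assoc[symmetric])
    qed simp
    moreover have "exp (\<Sum>k<m. p k *\<^sub>R (q k * (h k \<omega> - \<mu> k))) \<le> (\<Sum>k<m. p k * exp (q k * (h k \<omega> - \<mu> k)))"
      using convex_on_exp[of 1] p0 p1 m0 by (intro convex_on_sum[where C = UNIV]) auto
    ultimately show ?thesis by simp
  qed
  have "(\<integral>\<omega>. exp (s * Y \<omega>) \<partial>M) \<le> (\<integral>\<omega>. (\<Sum>k<m. p k * exp (q k * (h k \<omega> - \<mu> k))) \<partial>M)"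
    by (rule integral_mono[OF inteY _ conv]) (use inte in auto)
  also have "\<dots> = (\<Sum>k<m. p k * (\<integral>\<omega>. exp (q k * (h k \<omega> - \<mu> k)) \<partial>M))"
    using inte by (subst Bochner_Integration.integral_sum) auto
  also have "\<dots> \<le> (\<Sum>k<m. p k * exp (s\<^sup>2 * R\<^sup>2 / 8))"
    using mgf p0 by (intro sum_mono mult_left_mono) auto
  also have "\<dots> = exp (s\<^sup>2 * R\<^sup>2 / 8)"
    unfolding sum_distrib_right[symmetric] p1 by simp
  finally have mgfY: "(\<integral>\<omega>. exp (s * Y \<omega>) \<partial>M) \<le> exp (s\<^sup>2 * R\<^sup>2 / 8)" .
  have "prob {\<omega> \<in> space M. Y \<omega> \<ge> t} \<le> exp (- s * t) * (\<integral>\<omega>\<in>space M. exp (s * Y \<omega>) \<partial>M)"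
    using s integrable_mult_indicator[OF sets.top inteY]
    by (intro Chernoff_ineq_ge) (simp_all add: set_integrable_def)
  also have "(\<integral>\<omega>\<in>space M. exp (s * Y \<omega>) \<partial>M) = (\<integral>\<omega>. exp (s * Y \<omega>) \<partial>M)"
    by (rule set_integral_space[OF inteY])
  also have "exp (- s * t) * (\<integral>\<omega>. exp (s * Y \<omega>) \<partial>M) \<le> exp (- s * t) * exp (s\<^sup>2 * R\<^sup>2 / 8)"
    using mgfY by (intro mult_left_mono) auto
  also have "\<dots> = exp (- (2 * t\<^sup>2 / R\<^sup>2))"
  proof -
    have "- s * t + s\<^sup>2 * R\<^sup>2 / 8 = - (2 * t\<^sup>2 / R\<^sup>2)"
      unfolding s_def using Rpos by (simp add: field_simps power2_eq_square)
    thus ?thesis by (simp add: exp_add[symmetric])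
  qed
  also have "{\<omega> \<in> space M. Y \<omega> \<ge> t} = {\<omega> \<in> space M. f (X \<omega>) - (\<integral>\<omega>'. f (X \<omega>') \<partial>M) \<ge> t}"
    using Y by auto
  finally show "\<P>(\<omega> in M. f (X \<omega>) - (\<integral>\<omega>'. f (X \<omega>') \<partial>M) \<ge> t) \<le> exp (- (2 * t\<^sup>2 / R\<^sup>2))" .
qed

section \<open>The optimal cover\<close>

lemma is_forest_singleton:
  shows "is_forest (induced G {v})"
proof -
  have "component_of (induced G {v}) v = {v}"
    by (auto simp: component_of_induced)
  hence "component_sets (induced G {v}) = {{v}}" by (simp add: component_sets_def)
  moreover have "\<not> is_cycle (induced (induced G {v}) {v}) p" for p
  proof
    assume cyc: "is_cycle (induced (induced G {v}) {v}) p"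
    hence "3 \<le> length p" "distinct p" by (auto simp: is_cycle_def)
    hence "p ! 0 \<noteq> p ! 1" by (subst nth_eq_iff_index_eq) auto
    moreover have "p ! i = v" if "i < 3" for i
      using cyc that unfolding is_cycle_def adjacent_induced by auto
    ultimately show False by simp
  qed
  ultimately show ?thesis
    unfolding is_forest_def is_tree_def by simp
qed

lemma forest_cost_empty: "simple_graph G \<Longrightarrow> forest_cost G c {} = 0"
  by (auto simp: forest_cost_def component_sets_def induced_def simple_graph_def)

text \<open>
  A cover is encoded by the total weights \<open>u F\<close> of the nonempty \<open>F\<close> inducing a forest.  The empty set is
  left out: it has cost 0, but its total weight in a cover is unbounded.
\<close>

definition forest_sets :: "'v sgraph \<Rightarrow> 'v set set" where
  "forest_sets G = {F. F \<subseteq> verts G \<and> F \<noteq> {} \<and> is_forest (induced G F)}"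

definition cover_weights :: "'v sgraph \<Rightarrow> ('v set \<Rightarrow> real) set" where
  "cover_weights G = {u. (\<forall>F. u F \<in> (if F \<in> forest_sets G then {0..1} else {0})) \<and>
     (\<forall>v\<in>verts G. (\<Sum>F | F \<in> forest_sets G \<and> v \<in> F. u F) = 1)}"

definition weights_cost :: "'v sgraph \<Rightarrow> ('v \<Rightarrow> real) \<Rightarrow> ('v set \<Rightarrow> real) \<Rightarrow> real" where
  "weights_cost G c u = (\<Sum>F\<in>forest_sets G. u F * sqrt (forest_cost G c F))"

lemma finite_forest_sets: "simple_graph G \<Longrightarrow> finite (forest_sets G)"
  unfolding forest_sets_def simple_graph_def by (rule finite_subset[of _ "Pow (verts G)"]) auto

text \<open>By Tychonoff's theorem: every coordinate ranges over a compact set, those outside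
  \<open>forest_sets G\<close> being pinned to 0, and the covering equations are closed
  conditions.\<close>

lemma compact_cover_weights:
  assumes "simple_graph G"
  shows "compact (cover_weights G)"
proof -
  let ?B = "\<lambda>F. if F \<in> forest_sets G then {0..1} else {0 :: real}"
  have "compactin (product_topology (\<lambda>_. euclidean) UNIV) (PiE UNIV ?B)"
    unfolding compactin_PiE by simp
  hence "compact (PiE UNIV ?B)" by (simp add: euclidean_product_topology)
  moreover have "closed {u. (\<Sum>F | F \<in> forest_sets G \<and> v \<in> F. u F) = (1 :: real)}" for v
    by (intro closed_Collect_eq continuous_on_sum continuous_on_product_coordinates continuous_on_const)
  hence "closed (\<Inter>v\<in>verts G. {u. (\<Sum>F | F \<in> forest_sets G \<and> v \<in> F. u F) = (1 :: real)})" by blast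
  ultimately have "compact (PiE UNIV ?B \<inter> (\<Inter>v\<in>verts G. {u. (\<Sum>F | F \<in> forest_sets G \<and> v \<in> F. u F) = 1}))"
    by (rule compact_Int_closed)
  also have "PiE UNIV ?B \<inter> (\<Inter>v\<in>verts G. {u. (\<Sum>F | F \<in> forest_sets G \<and> v \<in> F. u F) = 1}) = cover_weights G"
    unfolding cover_weights_def by (simp add: set_eq_iff PiE_UNIV_domain Pi_iff)
  finally show ?thesis .
qed

text \<open>The singletons with weight 1 cover each vertex exactly once.\<close>

lemma cover_weights_nonempty:
  assumes G: "simple_graph G"
  shows "cover_weights G \<noteq> {}"
proof -
  let ?u = "\<lambda>F. of_bool (\<exists>v\<in>verts G. F = {v}) :: real"
  have sing: "{v} \<in> forest_sets G" if "v \<in> verts G" for v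
    using that is_forest_singleton[of G v] by (simp add: forest_sets_def)
  have "(\<Sum>F | F \<in> forest_sets G \<and> v \<in> F. ?u F) = 1" if v: "v \<in> verts G" for v
  proof -
    have "(\<Sum>F | F \<in> forest_sets G \<and> v \<in> F. ?u F) = (\<Sum>F\<in>{{v}}. ?u F)"
      by (rule sum.mono_neutral_right) (use finite_forest_sets[OF G] sing[OF v] in auto)
    thus ?thesis using v by simp
  qed
  hence "?u \<in> cover_weights G" using sing by (auto simp: cover_weights_def)
  thus ?thesis by blast
qed

lemma cover_of_weights:
  assumes G: "simple_graph G" and u: "u \<in> cover_weights G"
  shows "\<exists>C\<in>FFC G. cover_cost G c C = (weights_cost G c u)\<^sup>2"
proof -
  obtain xs where xs: "set xs = forest_sets G" "distinct xs"
    using finite_distinct_list[OF finite_forest_sets[OF G]] by blast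
  let ?C = "map (\<lambda>F. (F, u F)) xs"
  have bij: "bij_betw (\<lambda>k. xs ! k) {..<length xs} (forest_sets G)"
    using bij_betw_nth[OF xs(2)] xs(1) by auto
  have "(\<Sum>k | k < length ?C \<and> v \<in> fst (?C ! k). snd (?C ! k)) = 1" if v: "v \<in> verts G" for v
  proof -
    have "bij_betw (\<lambda>k. xs ! k) {k. k < length xs \<and> v \<in> xs ! k} {F. F \<in> forest_sets G \<and> v \<in> F}"
      by (rule bij_betw_subset[OF bij]) (use bij in \<open>auto simp: bij_betw_def xs(1)[symmetric] in_set_conv_nth\<close>)
    hence "(\<Sum>k | k < length xs \<and> v \<in> xs ! k. u (xs ! k)) = (\<Sum>F | F \<in> forest_sets G \<and> v \<in> F. u F)"
      by (rule sum.reindex_bij_betw)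
    also have "\<dots> = 1" using u v by (simp add: cover_weights_def)
    also have "(\<Sum>k | k < length xs \<and> v \<in> xs ! k. u (xs ! k)) =
        (\<Sum>k | k < length ?C \<and> v \<in> fst (?C ! k). snd (?C ! k))"
      by (rule sum.cong) auto
    finally show ?thesis .
  qed
  moreover have "S \<subseteq> verts G \<and> 0 \<le> w \<and> w \<le> 1 \<and> is_forest (induced G S)" if "(S, w) \<in> set ?C" for S w
  proof -
    have "S \<in> forest_sets G" "w = u S" using that xs(1) by auto
    moreover have "u S \<in> (if S \<in> forest_sets G then {0..1} else {0})"
      using u unfolding cover_weights_def by blast
    ultimately show ?thesis by (auto simp: forest_sets_def)
  qed
  ultimately have FFC: "?C \<in> FFC G"
    unfolding FFC_def fractional_cover_def mem_Collect_eq Ball_def split_paired_All by simp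
  have "(\<Sum>k<length ?C. snd (?C ! k) * sqrt (forest_cost G c (fst (?C ! k)))) = weights_cost G c u"
  proof -
    have "(\<Sum>k<length xs. u (xs ! k) * sqrt (forest_cost G c (xs ! k))) = weights_cost G c u"
      unfolding weights_cost_def by (rule sum.reindex_bij_betw[OF bij])
    thus ?thesis by simp
  qed
  with FFC show ?thesis unfolding cover_cost_eq by (intro bexI[of _ ?C]) simp_all
qed

lemma weights_of_cover:
  assumes G: "simple_graph G" and C: "C \<in> FFC G"
  shows "\<exists>u\<in>cover_weights G. cover_cost G c C = (weights_cost G c u)\<^sup>2"
proof -
  define m F w where "m = length C" and "F k = fst (C ! k)" and "w k = snd (C ! k)" for k
  have Fk: "F k \<subseteq> verts G" "0 \<le> w k" "is_forest (induced G (F k))" if "k < m" for k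
    using FFC_D[OF C] that by (auto simp: m_def F_def w_def)
  have cov: "(\<Sum>k | k < m \<and> v \<in> F k. w k) = 1" if "v \<in> verts G" for v
    using FFC_sum[OF C that] by (simp add: m_def F_def w_def)
  let ?P = "forest_sets G"
  define u where "u S = (if S \<in> ?P then \<Sum>k | k < m \<and> F k = S. w k else 0)" for S
  have finP: "finite ?P" by (rule finite_forest_sets[OF G])
  have FP: "F k \<in> ?P" if "k < m" "F k \<noteq> {}" for k
    using Fk[OF that(1)] that by (simp add: forest_sets_def)
  have u01: "u S \<in> (if S \<in> ?P then {0..1} else {0})" for S
  proof (cases "S \<in> ?P")
    case True
    \<comment> \<open>Nonemptiness of S matters here: all copies of S contain v, so their total
      weight is at most the total 1 at v.\<close>
    then obtain v where v: "v \<in> S" "v \<in> verts G" by (auto simp: forest_sets_def)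
    have "(\<Sum>k | k < m \<and> F k = S. w k) \<le> (\<Sum>k | k < m \<and> v \<in> F k. w k)"
      by (rule sum_mono2) (use v Fk in auto)
    moreover have "0 \<le> (\<Sum>k | k < m \<and> F k = S. w k)" by (rule sum_nonneg) (use Fk in auto)
    ultimately show ?thesis using True cov[OF v(2)] by (simp add: u_def)
  qed (simp add: u_def)
  have "(\<Sum>S | S \<in> ?P \<and> v \<in> S. u S) = 1" if v: "v \<in> verts G" for v
  proof -
    have "(\<Sum>S | S \<in> ?P \<and> v \<in> S. u S) =
        (\<Sum>S | S \<in> ?P \<and> v \<in> S. \<Sum>k\<in>{k \<in> {k. k < m \<and> v \<in> F k}. F k = S}. w k)"
      by (rule sum.cong) (auto simp: u_def intro!: sum.cong)
    also have "\<dots> = (\<Sum>k | k < m \<and> v \<in> F k. w k)"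
      by (rule sum.group) (use finP FP in auto)
    finally show ?thesis using cov[OF v] by simp
  qed
  hence uW: "u \<in> cover_weights G" using u01 by (simp add: cover_weights_def)
  have "weights_cost G c u = (\<Sum>S\<in>?P. \<Sum>k\<in>{k \<in> {k. k < m \<and> F k \<noteq> {}}. F k = S}. w k * sqrt (forest_cost G c (F k)))"
    unfolding weights_cost_def
  proof (rule sum.cong)
    fix S assume S: "S \<in> ?P"
    hence "u S * sqrt (forest_cost G c S) = (\<Sum>k | k < m \<and> F k = S. w k * sqrt (forest_cost G c S))"
      by (simp add: u_def sum_distrib_right)
    also have "\<dots> = (\<Sum>k\<in>{k \<in> {k. k < m \<and> F k \<noteq> {}}. F k = S}. w k * sqrt (forest_cost G c (F k)))"
      by (rule sum.cong) (use S in \<open>auto simp: forest_sets_def\<close>)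
    finally show "u S * sqrt (forest_cost G c S) =
      (\<Sum>k\<in>{k \<in> {k. k < m \<and> F k \<noteq> {}}. F k = S}. w k * sqrt (forest_cost G c (F k)))" .
  qed simp
  also have "\<dots> = (\<Sum>k | k < m \<and> F k \<noteq> {}. w k * sqrt (forest_cost G c (F k)))"
    by (rule sum.group) (use finP FP in auto)
  also have "\<dots> = (\<Sum>k<m. w k * sqrt (forest_cost G c (F k)))"
    by (rule sum.mono_neutral_left) (auto simp: forest_cost_empty[OF G])
  finally have "cover_cost G c C = (weights_cost G c u)\<^sup>2"
    by (simp add: cover_cost_eq m_def F_def w_def)
  thus ?thesis using uW by blast
qed

lemma D_cost_attained:
  assumes G: "simple_graph G"
  shows "\<exists>C\<in>FFC G. D_cost G c = cover_cost G c C"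
proof -
  have "continuous_on (cover_weights G) (weights_cost G c)"
    unfolding weights_cost_def
    by (intro continuous_on_sum continuous_on_mult_right continuous_on_subset[OF continuous_on_product_coordinates]) simp
  then obtain u where u: "u \<in> cover_weights G"
    "\<And>u'. u' \<in> cover_weights G \<Longrightarrow> weights_cost G c u \<le> weights_cost G c u'"
    using continuous_attains_inf[OF compact_cover_weights[OF G] cover_weights_nonempty[OF G]] by metis
  \<comment> \<open>The minimum was taken over the root of the cost; nonnegativity lets it pass to
    the square.\<close>
  have nonneg: "0 \<le> weights_cost G c u"
    unfolding weights_cost_def
  proof (intro sum_nonneg mult_nonneg_nonneg)
    fix F
    have "u F \<in> (if F \<in> forest_sets G then {0..1} else {0})"
      using u(1) unfolding cover_weights_def by blast
    thus "0 \<le> u F" by (auto split: if_splits)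
  qed (simp add: forest_cost_nonneg)
  obtain C where C: "C \<in> FFC G" "cover_cost G c C = (weights_cost G c u)\<^sup>2"
    using cover_of_weights[OF G u(1)] by blast
  have "D_cost G c = cover_cost G c C"
    unfolding D_cost_def
  proof (rule Least_equality)
    show "\<exists>C'\<in>FFC G. cover_cost G c C = cover_cost G c C'" using C(1) by blast
    fix d assume "\<exists>C\<in>FFC G. d = cover_cost G c C"
    then obtain C' where "C' \<in> FFC G" "d = cover_cost G c C'" by blast
    then obtain u' where "u' \<in> cover_weights G" "d = (weights_cost G c u')\<^sup>2"
      using weights_of_cover[OF G] by metis
    thus "cover_cost G c C \<le> d" using u(2) nonneg C(2) by (simp add: power_mono)
  qed
  thus ?thesis using C(1) by blast
qed

text \<open>For zero cost the exponential is read as its limit 0, whereas division by zero would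
  produce the trivial bound 1. Both cases arise by letting \<epsilon> tend to 0 in the bound for one
  optimal cover.\<close>

theorem theorem2p4:
  fixes n :: nat
    and \<Omega> :: "nat \<Rightarrow> 'a topology"
    and c :: "nat \<Rightarrow> real"
    and G :: "nat sgraph"
    and M :: "'w measure"
    and X :: "'w \<Rightarrow> nat \<Rightarrow> 'a"
    and f :: "(nat \<Rightarrow> 'a) \<Rightarrow> real"
    and t :: real
  assumes "n \<ge> 1"
    and "\<And>i. i \<in> {1..n} \<Longrightarrow> polish_top (\<Omega> i)"
    and "\<And>i. i \<in> {1..n} \<Longrightarrow> 0 \<le> c i"
    and "simple_graph G"
    and "verts G = {1..n}"
    and "prob_space M"
    and "X \<in> measurable M (prod_space \<Omega> {1..n})"
    and "graph_dependent M \<Omega> G X"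
    and "f \<in> borel_measurable (prod_space \<Omega> {1..n})"
    and "forest_decomposable \<Omega> c G f"
    and "t > 0"
  shows "\<P>(\<omega> in M. f (X \<omega>) - (\<integral>\<omega>'. f (X \<omega>') \<partial>M) \<ge> t)
       \<le> (if D_cost G c = 0 then 0 else exp (- (2 * t\<^sup>2 / D_cost G c)))"
proof -
  obtain C where C: "C \<in> FFC G" "D_cost G c = cover_cost G c C"
    using D_cost_attained[OF assms(4)] by blast
  define S W where "S = (\<Sum>k<length C. snd (C ! k) * sqrt (forest_cost G c (fst (C ! k))))"
    and "W = (\<Sum>k<length C. snd (C ! k))"
  have D: "D_cost G c = S\<^sup>2" unfolding C(2) cover_cost_eq S_def ..
  let ?P = "\<P>(\<omega> in M. f (X \<omega>) - (\<integral>\<omega>'. f (X \<omega>') \<partial>M) \<ge> t)"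
  have R: "(\<Sum>k<length C. snd (C ! k) * (sqrt (forest_cost G c (fst (C ! k))) + \<epsilon>)) = S + \<epsilon> * W" for \<epsilon>
    unfolding S_def W_def sum_distrib_left sum.distrib[symmetric]
    by (rule sum.cong) (simp_all add: algebra_simps)
  have V: "verts G \<noteq> {}" using assms(1,5) by simp
  have bound: "?P \<le> exp (- (2 * t\<^sup>2 / (S + \<epsilon> * W)\<^sup>2))" and pos: "S + \<epsilon> * W > 0" if "\<epsilon> > 0" for \<epsilon>
    using cover_tail_bound[OF assms(6) assms(7)[folded assms(5)] assms(8) assms(2)[folded assms(5)] assms(4) V
        assms(3)[folded assms(5)] assms(10) C(1) assms(11) that] unfolding R by auto
  have ev: "eventually (\<lambda>\<epsilon>::real. \<epsilon> > 0) (at_right 0)" by (rule eventually_at_right_less)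
  show ?thesis
  proof (cases "S = 0")
    case True
    have "((\<lambda>\<epsilon>. (\<epsilon> * W)\<^sup>2 / (2 * t\<^sup>2)) \<longlongrightarrow> 0) (at_right 0)"
      using assms(11) by (auto intro!: tendsto_eq_intros)
    moreover have "?P \<le> (\<epsilon> * W)\<^sup>2 / (2 * t\<^sup>2)" if e: "\<epsilon> > 0" for \<epsilon>
    proof -
      \<comment> \<open>From \<open>exp y \<ge> 1 + y\<close>, the bound \<open>exp (- y)\<close> is
        at most \<open>inverse y\<close>, a multiple of the square of \<epsilon>, whose limit is
        immediate.\<close>
      define y where "y = 2 * t\<^sup>2 / (\<epsilon> * W)\<^sup>2"
      have y: "y > 0" unfolding y_def using pos[OF e] True assms(11) by (intro divide_pos_pos) auto
      have "?P \<le> exp (- y)" using bound[OF e] True by (simp add: y_def)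
      also have "\<dots> = inverse (exp y)" by (rule exp_minus)
      also have "\<dots> \<le> inverse y" using y exp_ge_add_one_self[of y] by (intro le_imp_inverse_le) linarith+
      also have "\<dots> = (\<epsilon> * W)\<^sup>2 / (2 * t\<^sup>2)" by (simp add: y_def)
      finally show ?thesis .
    qed
    with ev have "eventually (\<lambda>\<epsilon>. ?P \<le> (\<epsilon> * W)\<^sup>2 / (2 * t\<^sup>2)) (at_right 0)"
      by (simp add: eventually_mono)
    ultimately have "?P \<le> 0" by (rule tendsto_lowerbound) simp
    thus ?thesis by (simp add: D True)
  next
    case False
    have "((\<lambda>\<epsilon>. exp (- (2 * t\<^sup>2 / (S + \<epsilon> * W)\<^sup>2))) \<longlongrightarrow> exp (- (2 * t\<^sup>2 / S\<^sup>2))) (at_right 0)"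
      using False by (auto intro!: tendsto_eq_intros)
    moreover have "eventually (\<lambda>\<epsilon>. ?P \<le> exp (- (2 * t\<^sup>2 / (S + \<epsilon> * W)\<^sup>2))) (at_right 0)"
      using ev bound by (simp add: eventually_mono)
    ultimately have "?P \<le> exp (- (2 * t\<^sup>2 / S\<^sup>2))" by (rule tendsto_lowerbound) simp
    thus ?thesis using False by (simp add: D)
  qed
qed

end
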